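(* In the setting described in the context, let $S:\Theta\to 2^H$ be any solution concept nested into $S_R$, i.e. $S(\theta)\subseteq S_R(\theta)$ for all $\theta\in\Theta$, and let $\Psi_R\subseteq\Theta\times H$ be the set of pairs $(\theta,h)$ satisfying Assumptions A1–A4 below. Then $S$ is discernible relative to $\Psi_R$.
   Context: Players $I=\{1,\dots,d_I\}$, $2\le d_I<\infty$, each choose $y_i\in\{0,1\}$; $Y=\{0,1\}^{d_I}$, $y_{-i}=(y_j)_{j\ne i}$. There is a random vector $(\mathbf z,\mathbf w,\mathbf e,\mathbf y)$: $\mathbf w$ has support $W\subseteq\mathbb R^{d_W}$, $\mathbf z=(\mathbf z_i)_{i\in I}\in\mathbb R^{d_I}$, $\mathbf x=(\mathbf z,\mathbf w)$ (values in $X$) observed covariates, $\mathbf e\in\mathbb R^{d_I}$ unobserved payoff shocks, $\mathbf y\in Y$ observed outcome; the distribution of $\mathbf x$ is fixed. A parameter is $\theta=(\alpha,\beta,\Sigma)$ with measurable $\alpha_{i,y_{-i}}:W\to\mathbb R$, $\beta_i:W\to\mathbb R$, $\Sigma:W\to\mathbb R^{d_I\times d_I}$; $\Theta$ is the set of parameters. Given $\theta$ and $(x,e)$, $x=(z,w)$, the players play the simultaneous-move complete-information game with payoffs $\pi_{i,y}(x,e,\theta)=y_i(\alpha_{i,y_{-i}}(w)+\beta_i(w)z_i-e_i)$. A distribution of play is a measurable $h:Y\times X\times\mathbb R^{d_I}\to[0,1]$ with $\sum_y h(y,x,e)=1$; $H$ is the set of these; $h=h'$ means $h(\mathbf x,\mathbf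 e)=h'(\mathbf x,\mathbf e)$ a.s. $\mathbb E[h(\mathbf x,\mathbf e)\mid\mathbf x;\theta]$ denotes the expectation of $h(\mathbf x,\mathbf e)=(h(y,\mathbf x,\mathbf e))_{y\in Y}$ with respect to the conditional law $N(0,\Sigma(\mathbf w))$ of $\mathbf e$ given $\mathbf x$ implied by $\theta$. A solution concept is a map $S:\Theta\to2^H$. $S_R(\theta)$ is the set of $h\in H$ such that for all $x,e$, $h(x,e)$ puts positive probability only on rationalizable outcomes (profiles of actions surviving iterated elimination of strictly dominated strategies) of the game with payoffs $\pi(x,e,\theta)$. Discernibility: given $\Psi\subseteq\Theta\times H$, $S$ is discernible relative to $\Psi$ if there do not exist $(\theta,h),(\theta',h')\in\Psi$ with $h\in S(\theta)$, $h'\notin S(\theta')$ and $\mathbb E[h(\mathbf x,\mathbf e)\mid\mathbf x;\theta]=\mathbb E[h'(\mathbf x,\mathbf e)\mid\mathbf x;\theta']$ almost surely. Assumptions on a pair $(\theta,h)$: (A1) for all $w\in W$ the support of $\mathbf z$ given $\mathbf w=w$ is $\mathbb R^{d_I}$, and $\beta_i(w)\ne0$ for all $i,w$; (A2) $\mathbf e\mid(\mathbf z=z,\mathbf w=w)\sim N(0,\Sigma(w))$ for all $z,w$, with $\Sigma(w)$ symmetric positive definite and $\Sigma_{ii}(w)=1$; (A3) there is a measurable $\tilde h$ with $h(\mathbf x,\mathbf e)=\tilde h(\mathbf w,\mathbf v)$ a.s., where $\mathbf v_i=\beta_i(\mathbf w)\mathbf z_i-\mathbf e_i$; (A4) $h\in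 S_R(\theta)$.
   Formalization: The formal theorem also assumes that S respects null sets: if h is in S(θ), h' is in S_R(θ'), θ = θ' for almost every w, and h = h' almost surely, then h' is in S(θ'). Without this the claim fails when θ and θ' differ only on a null set of w. *)

theory Defs
  imports "HOL-Probability.Probability"
begin

text \<open>Players are the elements of a finite type 'i (d_I = CARD('i)); covariate w lives in
  real^'dw. An outcome y in Y = {0,1}^{d_I} is a map 'i => bool. Covariates x = (z,w).\<close>

type_synonym ('i,'dw) cov = "(real^'i) \<times> (real^'dw)"

text \<open>A parameter theta = (alpha, beta, Sigma). alpha i y w stands for alpha_{i,y_{-i}}(w);
  membership in Theta requires that it does not depend on y i.\<close>
type_synonym ('i,'dw) param =
  "('i \<Rightarrow> ('i \<Rightarrow> bool) \<Rightarrow> real^'dw \<Rightarrow> real) \<times> ('i \<Rightarrow> real^'dw \<Rightarrow> real) \<times> (real^'dw \<Rightarrow> real^'i^'i)"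

type_synonym ('i,'dw) play = "('i \<Rightarrow> bool) \<Rightarrow> ('i,'dw) cov \<Rightarrow> real^'i \<Rightarrow> real"

definition alpha :: "('i::finite,'dw::finite) param \<Rightarrow> 'i \<Rightarrow> ('i \<Rightarrow> bool) \<Rightarrow> real^'dw \<Rightarrow> real"
  where "alpha \<theta> = fst \<theta>"
definition beta :: "('i::finite,'dw::finite) param \<Rightarrow> 'i \<Rightarrow> real^'dw \<Rightarrow> real"
  where "beta \<theta> = fst (snd \<theta>)"
definition Sigma :: "('i::finite,'dw::finite) param \<Rightarrow> real^'dw \<Rightarrow> real^'i^'i"
  where "Sigma \<theta> = snd (snd \<theta>)"

definition Theta :: "('i::finite,'dw::finite) param set" where
  "Theta = {\<theta>. (\<forall>i y. alpha \<theta> i y \<in> borel_measurable borel)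
             \<and> (\<forall>i y y' w. (\<forall>j. j \<noteq> i \<longrightarrow> y j = y' j) \<longrightarrow> alpha \<theta> i y w = alpha \<theta> i y' w)
             \<and> (\<forall>i. beta \<theta> i \<in> borel_measurable borel)
             \<and> Sigma \<theta> \<in> borel_measurable borel}"

definition Hset :: "('i::finite,'dw::finite) play set" where
  "Hset = {h. (\<forall>y. (\<lambda>(x,e). h y x e) \<in> borel_measurable (borel \<Otimes>\<^sub>M borel))
             \<and> (\<forall>y x e. 0 \<le> h y x e \<and> h y x e \<le> 1)
             \<and> (\<forall>x e. (\<Sum>y\<in>UNIV. h y x e) = 1)}"

definition payoff :: "('i::finite,'dw::finite) param \<Rightarrow> ('i,'dw) cov \<Rightarrow> real^'i \<Rightarrow> 'i \<Rightarrow> ('i \<Rightarrow> bool) \<Rightarrow> real" where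
  "payoff \<theta> x e i y = (if y i then alpha \<theta> i y (snd x) + beta \<theta> i (snd x) * (fst x $ i) - e $ i else 0)"

text \<open>Iterated (simultaneous) elimination of strictly dominated strategies; a strategy
  is strictly dominated if some mixed strategy over the surviving strategies does strictly
  better against every surviving opponent profile.\<close>
primrec surv :: "('i::finite,'dw::finite) param \<Rightarrow> ('i,'dw) cov \<Rightarrow> real^'i \<Rightarrow> nat \<Rightarrow> 'i \<Rightarrow> bool set" where
  "surv \<theta> x e 0 = (\<lambda>i. UNIV)"
| "surv \<theta> x e (Suc k) = (\<lambda>i. {a \<in> surv \<theta> x e k i.
      \<not> (\<exists>q::real. 0 \<le> q \<and> q \<le> 1
           \<and> (0 < q \<longrightarrow> True \<in> surv \<theta> x e k i) \<and> (q < 1 \<longrightarrow> False \<in> surv \<theta> x e k i)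
           \<and> (\<forall>y. (\<forall>j. j \<noteq> i \<longrightarrow> y j \<in> surv \<theta> x e k j) \<longrightarrow>
                q * payoff \<theta> x e i (y(i := True)) + (1 - q) * payoff \<theta> x e i (y(i := False))
                  > payoff \<theta> x e i (y(i := a))))})"

definition rationalizable :: "('i::finite,'dw::finite) param \<Rightarrow> ('i,'dw) cov \<Rightarrow> real^'i \<Rightarrow> ('i \<Rightarrow> bool) set" where
  "rationalizable \<theta> x e = {y. \<forall>i k. y i \<in> surv \<theta> x e k i}"

definition S_R :: "('i::finite,'dw::finite) param \<Rightarrow> ('i,'dw) play set" where
  "S_R \<theta> = {h \<in> Hset. \<forall>x e y. h y x e > 0 \<longrightarrow> y \<in> rationalizable \<theta> x e}"

definition gauss_density :: "real^'i::finite^'i \<Rightarrow> real^'i \<Rightarrow> real" where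
  "gauss_density \<Sigma> e =
     exp (- (e \<bullet> (matrix_inv \<Sigma> *v e)) / 2) / sqrt ((2 * pi) ^ CARD('i) * det \<Sigma>)"

definition mvnormal :: "real^'i::finite^'i \<Rightarrow> (real^'i) measure" where
  "mvnormal \<Sigma> = density lborel (\<lambda>e. ennreal (gauss_density \<Sigma> e))"

definition condE :: "('i::finite,'dw::finite) param \<Rightarrow> ('i,'dw) play \<Rightarrow> ('i \<Rightarrow> bool) \<Rightarrow> ('i,'dw) cov \<Rightarrow> real" where
  "condE \<theta> h y x = (\<integral>e. h y x e \<partial>mvnormal (Sigma \<theta> (snd x)))"

definition Px :: "(real^'dw::finite) measure \<Rightarrow> (real^'dw \<Rightarrow> (real^'i::finite) measure) \<Rightarrow> ('i,'dw) cov measure" where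
  "Px Pw K = Pw \<bind> (\<lambda>w. distr (K w) borel (\<lambda>z. (z, w)))"

definition msupport :: "'a::topological_space measure \<Rightarrow> 'a set" where
  "msupport M = {a. \<forall>U. open U \<longrightarrow> a \<in> U \<longrightarrow> 0 < emeasure M U}"

definition discernible ::
  "(real^'dw) measure \<Rightarrow> (real^'dw \<Rightarrow> (real^'i) measure) \<Rightarrow>
   (('i::finite,'dw::finite) param \<Rightarrow> ('i,'dw) play set) \<Rightarrow> (('i,'dw) param \<times> ('i,'dw) play) set \<Rightarrow> bool" where
  "discernible Pw K S \<Psi> \<longleftrightarrow>
     \<not> (\<exists>\<theta> h \<theta>' h'. (\<theta>, h) \<in> \<Psi> \<and> (\<theta>', h') \<in> \<Psi> \<and> h \<in> S \<theta> \<and> h' \<notin> S \<theta>'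
          \<and> (AE x in Px Pw K. \<forall>y. condE \<theta> h y x = condE \<theta>' h' y x))"

definition pos_def :: "real^'i::finite^'i \<Rightarrow> bool" where
  "pos_def A \<longleftrightarrow> transpose A = A \<and> (\<forall>v. v \<noteq> 0 \<longrightarrow> 0 < v \<bullet> (A *v v))"

text \<open>Assumptions A1--A4 on a pair (theta, h); Psi_R is the set of pairs satisfying them.
  A2's conditional-law part holds by construction (condE uses N(0, Sigma(w))).
  "Almost surely" for (x,e) is taken w.r.t. Px x Lebesgue, which has the same null sets
  as the joint law of (x,e) under theta when Sigma(w) is positive definite.\<close>
definition Psi_R :: "(real^'dw) measure \<Rightarrow> (real^'dw \<Rightarrow> (real^'i) measure) \<Rightarrow>
     (('i::finite,'dw::finite) param \<times> ('i,'dw) play) set" where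
  "Psi_R Pw K = {(\<theta>, h). \<theta> \<in> Theta \<and> h \<in> Hset
     \<and> (\<forall>w\<in>msupport Pw. msupport (K w) = UNIV \<and> (\<forall>i. beta \<theta> i w \<noteq> 0))
     \<and> (\<forall>w\<in>msupport Pw. pos_def (Sigma \<theta> w) \<and> (\<forall>i. Sigma \<theta> w $ i $ i = 1))
     \<and> (\<exists>ht :: ('i \<Rightarrow> bool) \<Rightarrow> real^'dw \<Rightarrow> real^'i \<Rightarrow> real.
          (\<forall>y. (\<lambda>(w,v). ht y w v) \<in> borel_measurable (borel \<Otimes>\<^sub>M borel))
          \<and> (AE (x,e) in Px Pw K \<Otimes>\<^sub>M lborel. \<forall>y.
               h y x e = ht y (snd x) (\<chi> i. beta \<theta> i (snd x) * (fst x $ i) - e $ i)))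
     \<and> h \<in> S_R \<theta>}"

definition param_ae_eq :: "(real^'dw::finite) measure \<Rightarrow> ('i::finite,'dw) param \<Rightarrow> ('i,'dw) param \<Rightarrow> bool" where
  "param_ae_eq Pw \<theta> \<theta>' \<longleftrightarrow> (AE w in Pw. (\<forall>i y. alpha \<theta> i y w = alpha \<theta>' i y w)
       \<and> (\<forall>i. beta \<theta> i w = beta \<theta>' i w) \<and> Sigma \<theta> w = Sigma \<theta>' w)"

definition play_ae_eq :: "(real^'dw) measure \<Rightarrow> (real^'dw \<Rightarrow> (real^'i) measure) \<Rightarrow>
     ('i::finite,'dw::finite) play \<Rightarrow> ('i,'dw) play \<Rightarrow> bool" where
  "play_ae_eq Pw K h h' \<longleftrightarrow> (AE (x,e) in Px Pw K \<Otimes>\<^sub>M lborel. \<forall>y. h y x e = h' y x e)"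

end

theory Submission
  imports Defs "HOL-Real_Asymp.Real_Asymp"
begin

text \<open>Fix a typical \<open>w\<close> and write \<open>v = \<beta> z - e\<close>. Both sides of the equality of conditional choice
  probabilities are Gaussian convolutions of bounded functions, hence continuous in \<open>z\<close>, so the
  equality holds for all \<open>z\<close>. Because actions become dominant for large \<open>\<bar>v\<^sub>i\<bar>\<close>, the probability that
  \<open>i\<close> and \<open>j\<close> both enter lies between two Gaussian orthant probabilities, which decay like
  \<open>exp (- s\<^sup>2 / (1 + \<Sigma>\<^sub>i\<^sub>j))\<close> when \<open>\<beta>\<^sub>i z\<^sub>i = \<beta>\<^sub>j z\<^sub>j = - s\<close>. The decay rates identify \<open>\<beta>\<close> (take \<open>i = j\<close>) and
  then \<open>\<Sigma>\<close>. With \<open>\<beta>\<close> and \<open>\<Sigma>\<close> known, the convolution with the normal density can be inverted, so the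
  distribution of play is identified as a function of \<open>v\<close>. Where the actions of the other players
  are dominant, player \<open>i\<close> enters iff \<open>v\<^sub>i\<close> exceeds \<open>- \<alpha>\<^sub>i\<close> at these actions, which identifies \<open>\<alpha>\<close>.
  Hence observationally equivalent pairs agree almost surely, and a solution concept that respects
  null sets cannot separate them.\<close>

section \<open>Injectivity of Gaussian convolution\<close>

text \<open>What the convolution yields is a real Laplace transform that vanishes everywhere. It is
  inverted without complex arguments: differentiation brings down powers of the quadratic form
  \<open>Q\<close>, a power series in them strengthens the Gaussian factor
  \<open>exp (- c * Q v)\<close> to any exponent below \<open>2 * c\<close>, and iteration makes the
  Gaussian as narrow as desired, that is, an approximate identity. The tail comparison works without
  knowing \<alpha> or how play is selected among several rationalizable outcomes: these only confine
  joint entry between two orthants that are a bounded shift apart, and such a shift changes the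
  exponent by terms of lower order than \<open>s\<^sup>2\<close>. The law of \<open>z\<close> given
  \<open>w\<close> has full support but may have no density, and play is determined only up to null
  sets. Information must therefore be read off open sets: a dense set of \<open>z\<close> together
  with continuity, and open sets of \<open>v\<close> for the thresholds.\<close>

lemma lborel_integral_affine:
  fixes f :: "'a::euclidean_space \<Rightarrow> real"
  assumes [measurable]: "f \<in> borel_measurable borel" and c: "c \<noteq> 0"
  shows "(\<integral>x. f x \<partial>lborel) = \<bar>c\<bar> ^ DIM('a) * (\<integral>x. f (t + c *\<^sub>R x) \<partial>lborel)"
  by (subst lborel_affine[OF c, of t])
    (simp add: integral_density integral_distr)

lemma lborel_distr_isometric_affine:
  fixes t :: "'a::euclidean_space"
  assumes "\<bar>c\<bar> = 1"
  shows "distr lborel borel (\<lambda>x. t + c *\<^sub>R x) = lborel"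
  using lborel_affine[of c t] assms by (auto simp: density_1)

lemma lborel_distr_reflect:
  fixes t :: "'a::euclidean_space"
  shows "distr lborel borel (\<lambda>x. t - x) = lborel"
  using lborel_distr_isometric_affine[of "-1" t] by simp

lemma AE_lborel_reflect_iff:
  fixes t :: "'a::euclidean_space"
  shows "(AE x in lborel. P (t - x)) \<longleftrightarrow> (AE x in lborel. P x)"
proof -
  have *: "AE x in lborel. R (s - x)" if "AE x in lborel. R x" for R and s :: 'a
  proof -
    \<comment> \<open>\<open>R\<close> need not be measurable, so a measurable null set containing
      its exceptions is transported instead.\<close>
    from that obtain N where N: "N \<in> null_sets lborel" "{x. \<not> R x} \<subseteq> N"
      by (auto simp: eventually_ae_filter)
    then have "AE x in lborel. x \<notin> N" by (simp add: AE_not_in)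
    then have "AE x in distr lborel borel (\<lambda>x. s - x). x \<notin> N"
      by (subst lborel_distr_reflect)
    then have "AE x in lborel. s - x \<notin> N"
      using N(1) by (subst (asm) AE_distr_iff) (auto simp: null_sets_def)
    then show ?thesis using N(2) by (auto elim!: eventually_mono)
  qed
  show ?thesis
    using *[of P t] *[of "\<lambda>x. P (t - x)" t] by (simp only: diff_diff_eq2 add_diff_cancel_left') blast
qed

lemma lborel_integral_reflect:
  fixes f :: "'a::euclidean_space \<Rightarrow> real"
  assumes [measurable]: "f \<in> borel_measurable borel"
  shows "(\<integral>x. f (t - x) \<partial>lborel) = (\<integral>x. f x \<partial>lborel)"
  using lborel_integral_affine[OF assms, of "-1" t] by simp

lemma nn_integral_lborel_translate:
  fixes f :: "'a::euclidean_space \<Rightarrow> ennreal"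
  assumes [measurable]: "f \<in> borel_measurable borel"
  shows "(\<integral>\<^sup>+x. f (x + t) \<partial>lborel) = (\<integral>\<^sup>+x. f x \<partial>lborel)"
proof -
  have "(\<integral>\<^sup>+x. f x \<partial>lborel) = (\<integral>\<^sup>+x. f x \<partial>distr lborel borel ((+) t))"
    by (simp add: lborel_distr_plus)
  also have "\<dots> = (\<integral>\<^sup>+x. f (x + t) \<partial>lborel)"
    by (subst nn_integral_distr) (auto simp: add.commute)
  finally show ?thesis by simp
qed

lemma open_AE_lborel_nonempty:
  fixes U :: "'a::euclidean_space set"
  assumes "AE x in lborel. P x" "open U" "U \<noteq> {}"
  shows "\<exists>x\<in>U. P x"
proof (rule ccontr)
  assume "\<not> ?thesis"
  then have "AE x in lborel. x \<notin> U" using assms(1) by (auto elim!: eventually_mono)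
  then have "U \<in> null_sets lborel" using \<open>open U\<close> by (subst AE_iff_null_sets) auto
  then have "negligible U"
    using negligible_iff_null_sets null_sets_completionI by blast
  then show False using open_not_negligible assms by blast
qed

lemma integrable_exp_neg_norm_square:
  fixes d :: real
  assumes d: "0 < d"
  shows "integrable lborel (\<lambda>v::'a::euclidean_space. exp (- d * (norm v)\<^sup>2))"
proof (rule integrableI_nonneg)
  have 1: "integrable lborel (\<lambda>x::real. exp (- d * x\<^sup>2))"
  proof -
    \<comment> \<open>The standard deviation whose normal density has exponent
      \<open>- d * x\<^sup>2\<close>.\<close>
    define s where "s = 1 / sqrt (2 * d)"
    have s: "0 < s" "s\<^sup>2 = 1 / (2 * d)" using d by (auto simp: s_def power_divide)
    have "integrable lborel (\<lambda>x. sqrt (2 * pi * s\<^sup>2) * normal_density 0 s x)"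
      using s by (intro integrable_mult_right) simp
    also have "(\<lambda>x. sqrt (2 * pi * s\<^sup>2) * normal_density 0 s x) = (\<lambda>x. exp (- d * x\<^sup>2))"
      using s d by (auto simp: normal_density_def fun_eq_iff mult.commute)
    finally show ?thesis .
  qed
  have "(\<integral>\<^sup>+v. ennreal (exp (- d * (norm v)\<^sup>2)) \<partial>(lborel :: 'a measure))
      = (\<integral>\<^sup>+v. (\<Prod>b\<in>Basis. ennreal (exp (- d * (v \<bullet> b)\<^sup>2))) \<partial>(lborel :: 'a measure))"
  proof (rule nn_integral_cong)
    fix v :: 'a
    have "(norm v)\<^sup>2 = (\<Sum>b\<in>Basis. (v \<bullet> b)\<^sup>2)"
      by (simp add: norm_eq_sqrt_inner euclidean_inner[of v v] power2_eq_square sum_nonneg)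
    then show "ennreal (exp (- d * (norm v)\<^sup>2)) = (\<Prod>b\<in>Basis. ennreal (exp (- d * (v \<bullet> b)\<^sup>2)))"
      by (simp add: prod_ennreal exp_sum[symmetric] sum_distrib_left sum_negf)
  qed
  also have "\<dots> = (\<Prod>b\<in>(Basis::'a set). (\<integral>\<^sup>+x. ennreal (exp (- d * x\<^sup>2)) \<partial>lborel))"
    by (rule nn_integral_lborel_prod) auto
  also have "\<dots> < \<infinity>"
    using 1 unfolding integrable_iff_bounded
    by (auto simp: power_less_top_ennreal)
  finally show "(\<integral>\<^sup>+v. ennreal (exp (- d * (norm v)\<^sup>2)) \<partial>(lborel :: 'a measure)) < \<infinity>" .
qed auto

section \<open>Laplace transforms that vanish identically\<close>

lemma abs_exp_difference_quotient_le:
  fixes x h :: real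
  assumes "0 < h" "h \<le> 1"
  shows "\<bar>(exp (h * x) - 1) / h\<bar> \<le> exp (2 * \<bar>x\<bar>)"
proof -
  have "\<bar>exp (h * x) - 1\<bar> \<le> h * exp (2 * \<bar>x\<bar>)"
  proof -
    have "1 + \<bar>x\<bar> \<le> exp \<bar>x\<bar>" by (rule exp_ge_add_one_self)
    then have x: "\<bar>x\<bar> \<le> exp \<bar>x\<bar>" by linarith
    have "exp (h*x) - 1 \<le> h * \<bar>x\<bar> * exp \<bar>x\<bar>"
    proof -
      \<comment> \<open>The inequality \<open>1 + t \<le> exp t\<close> is taken at
        \<open>t = - (h * x)\<close> and multiplied by \<open>exp (h * x)\<close>.\<close>
      have "1 + - (h * x) \<le> exp (- (h * x))" by (rule exp_ge_add_one_self)
      then have "(1 + - (h * x)) * exp (h * x) \<le> 1"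
        using mult_right_mono[of _ _ "exp (h*x)"] by (metis exp_ge_zero exp_minus_inverse mult.commute)
      then have "exp (h * x) - 1 \<le> (h * x) * exp (h * x)" by (simp add: algebra_simps)
      also have "\<dots> \<le> (h * \<bar>x\<bar>) * exp (h * x)"
        using assms by (intro mult_right_mono mult_left_mono) auto
      also have "\<dots> \<le> (h * \<bar>x\<bar>) * exp \<bar>x\<bar>"
      proof -
        have "h * x \<le> 1 * \<bar>x\<bar>" 
          using mult_mono[of h 1 "\<bar>x\<bar>" "\<bar>x\<bar>"] mult_left_mono[of x "\<bar>x\<bar>" h] assms by linarith
        then show ?thesis using assms by (intro mult_left_mono) auto
      qed
      finally show ?thesis .
    qed
    moreover have "1 - exp (h * x) \<le> h * \<bar>x\<bar> * exp \<bar>x\<bar>"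
    proof -
      have "1 + h * x \<le> exp (h * x)" by (rule exp_ge_add_one_self)
      then have "1 - exp (h * x) \<le> h * (- x)" by (simp only: mult_minus_right)
      also have "\<dots> \<le> h * \<bar>x\<bar>" using assms by (intro mult_left_mono) auto
      also have "\<dots> \<le> h * \<bar>x\<bar> * exp \<bar>x\<bar>" using mult_left_mono[of 1 "exp \<bar>x\<bar>" "h * \<bar>x\<bar>"] assms by simp
      finally show ?thesis .
    qed
    \<comment> \<open>Absorbing the factor \<open>\<bar>x\<bar>\<close> into a second exponential
      gives the 2; after division by \<open>h\<close> the bound is uniform in \<open>h\<close>, as
      dominated convergence requires.\<close>
    moreover have "h * \<bar>x\<bar> * exp \<bar>x\<bar> \<le> h * exp (2 * \<bar>x\<bar>)"
    proof -
      have "\<bar>x\<bar> * exp \<bar>x\<bar> \<le> exp \<bar>x\<bar> * exp \<bar>x\<bar>" using x by (intro mult_right_mono) auto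
      also have "\<dots> = exp (2 * \<bar>x\<bar>)" by (simp add: exp_add[symmetric])
      finally show ?thesis using assms by (simp add: mult.assoc)
    qed
    ultimately show ?thesis by linarith
  qed
  then show ?thesis using assms by (simp add: abs_divide divide_le_eq mult.commute)
qed

text \<open>All exponential moments are required, so that the class is closed under multiplication
  by linear functionals and the transform can be differentiated at every \<open>l\<close>.\<close>

definition null_laplace :: "('a::euclidean_space \<Rightarrow> real) \<Rightarrow> bool" where
  "null_laplace F \<longleftrightarrow> F \<in> borel_measurable borel
     \<and> (\<forall>R. integrable lborel (\<lambda>v. F v * exp (R * norm v)))
     \<and> (\<forall>l. (\<integral>v. F v * exp (l \<bullet> v) \<partial>lborel) = 0)"

lemma integrable_exp_inner:
  fixes F :: "'a::euclidean_space \<Rightarrow> real"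
  assumes [measurable]: "F \<in> borel_measurable borel"
    and int: "\<And>R. integrable lborel (\<lambda>v. F v * exp (R * norm v))"
  shows "integrable lborel (\<lambda>v. F v * exp (l \<bullet> v))"
proof (rule Bochner_Integration.integrable_bound[OF int[of "norm l"]])
  show "AE v in lborel. norm (F v * exp (l \<bullet> v)) \<le> norm (F v * exp (norm l * norm v))"
    by (auto simp: abs_mult intro!: mult_left_mono AE_I2 norm_cauchy_schwarz)
qed measurable

lemma null_laplace_add:
  assumes "null_laplace F" "null_laplace G"
  shows "null_laplace (\<lambda>v. F v + G v)"
  using assms integrable_exp_inner[of F] integrable_exp_inner[of G]
  unfolding null_laplace_def by (auto simp: distrib_right)

lemma null_laplace_cmult:
  assumes "null_laplace F"
  shows "null_laplace (\<lambda>v. c * F v)"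
  using assms integrable_exp_inner[of F]
  unfolding null_laplace_def by (auto simp: mult.assoc)

lemma null_laplace_zero: "null_laplace (\<lambda>v. 0)"
  by (auto simp: null_laplace_def)

lemma null_laplace_sum:
  assumes "\<And>i. i \<in> I \<Longrightarrow> null_laplace (F i)"
  shows "null_laplace (\<lambda>v. \<Sum>i\<in>I. F i v)"
  using assms by (induction I rule: infinite_finite_induct) (auto simp: null_laplace_zero null_laplace_add)

text \<open>The Laplace transform is differentiated in direction \<open>b\<close> under the integral sign.\<close>

lemma null_laplace_mult_inner:
  fixes F :: "'a::euclidean_space \<Rightarrow> real" and b :: 'a
  assumes F: "null_laplace F"
  shows "null_laplace (\<lambda>v. F v * (b \<bullet> v))"
proof -
  have meas[measurable]: "F \<in> borel_measurable borel"
    and int: "\<And>R. integrable lborel (\<lambda>v. F v * exp (R * norm v))"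
    and zero: "\<And>l. (\<integral>v. F v * exp (l \<bullet> v) \<partial>lborel) = 0"
    using F by (auto simp: null_laplace_def)
  have inner_le: "\<bar>b \<bullet> v\<bar> \<le> norm b * norm v" for v :: 'a
    by (rule Cauchy_Schwarz_ineq2)
  have "integrable lborel (\<lambda>v. F v * (b \<bullet> v) * exp (R * norm v))" for R
  proof (rule Bochner_Integration.integrable_bound[OF int[of "norm b + R"]])
    show "AE v in lborel. norm (F v * (b \<bullet> v) * exp (R * norm v)) \<le> norm (F v * exp ((norm b + R) * norm v))"
    proof (rule AE_I2)
      fix v :: 'a
      have "1 + norm b * norm v \<le> exp (norm b * norm v)" by (rule exp_ge_add_one_self)
      then have "\<bar>b \<bullet> v\<bar> \<le> exp (norm b * norm v)" using inner_le[of v] by linarith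
      then show "norm (F v * (b \<bullet> v) * exp (R * norm v)) \<le> norm (F v * exp ((norm b + R) * norm v))"
        by (auto simp: abs_mult distrib_right exp_add mult.assoc intro!: mult_left_mono mult_right_mono)
    qed
  qed measurable
  moreover have "(\<integral>v. F v * (b \<bullet> v) * exp (l \<bullet> v) \<partial>lborel) = 0" for l
  proof -
    let ?h = "\<lambda>n. 1 / real (Suc n)"
    let ?q = "\<lambda>n v. F v * ((exp (?h n * (b \<bullet> v)) - 1) / ?h n) * exp (l \<bullet> v)"
    have lim: "(\<lambda>n. \<integral>v. ?q n v \<partial>lborel) \<longlonglongrightarrow> (\<integral>v. F v * (b \<bullet> v) * exp (l \<bullet> v) \<partial>lborel)"
    proof (rule integral_dominated_convergence[where w="\<lambda>v. norm (F v * exp ((2 * norm b + norm l) * norm v))"])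
      show "integrable lborel (\<lambda>v. norm (F v * exp ((2 * norm b + norm l) * norm v)))"
        by (intro integrable_norm int)
      show "AE v in lborel. (\<lambda>n. ?q n v) \<longlonglongrightarrow> F v * (b \<bullet> v) * exp (l \<bullet> v)"
      proof (intro AE_I2 tendsto_intros)
        fix v :: 'a
        have "((\<lambda>h. exp (h * (b \<bullet> v))) has_field_derivative (b \<bullet> v)) (at 0)"
          by (auto intro!: derivative_eq_intros)
        then have "((\<lambda>h. (exp (h * (b \<bullet> v)) - 1) / h) \<longlongrightarrow> b \<bullet> v) (at 0)"
          by (simp add: DERIV_def)
        moreover have "filterlim ?h (at 0) sequentially"
          unfolding filterlim_at using LIMSEQ_Suc[OF lim_1_over_n] by (auto simp: lim_1_over_n)
        ultimately show "(\<lambda>n. (exp (?h n * (b \<bullet> v)) - 1) / ?h n) \<longlonglongrightarrow> b \<bullet> v"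
          by (rule filterlim_compose)
      qed
      fix n
      show "AE v in lborel. norm (?q n v) \<le> norm (F v * exp ((2 * norm b + norm l) * norm v))"
      proof (rule AE_I2)
        fix v :: 'a
        have "\<bar>(exp (?h n * (b \<bullet> v)) - 1) / ?h n\<bar> \<le> exp (2 * \<bar>b \<bullet> v\<bar>)"
          by (rule abs_exp_difference_quotient_le) auto
        also have "\<dots> \<le> exp (2 * norm b * norm v)" using inner_le[of v] by simp
        finally have 1: "\<bar>(exp (?h n * (b \<bullet> v)) - 1) / ?h n\<bar> \<le> exp (2 * norm b * norm v)" .
        have "norm (?q n v) = \<bar>F v\<bar> * \<bar>(exp (?h n * (b \<bullet> v)) - 1) / ?h n\<bar> * exp (l \<bullet> v)"
          by (simp only: real_norm_def abs_mult abs_exp_cancel)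
        also have "\<dots> \<le> \<bar>F v\<bar> * exp (2 * norm b * norm v) * exp (norm l * norm v)"
          using 1 norm_cauchy_schwarz[of l v] by (intro mult_mono) auto
        also have "\<dots> = norm (F v * exp ((2 * norm b + norm l) * norm v))"
          by (simp add: abs_mult distrib_right exp_add)
        finally show "norm (?q n v) \<le> norm (F v * exp ((2 * norm b + norm l) * norm v))" .
      qed
    qed measurable
    \<comment> \<open>The difference quotient only involves the transform at \<open>l\<close> and at
      \<open>l\<close> shifted by \<open>?h n *\<^sub>R b\<close>, where it is zero.\<close>
    have "(\<integral>v. ?q n v \<partial>lborel) = 0" for n
    proof -
      have "(\<integral>v. ?q n v \<partial>lborel)
          = (\<integral>v. real (Suc n) * (F v * exp ((?h n *\<^sub>R b + l) \<bullet> v) - F v * exp (l \<bullet> v)) \<partial>lborel)"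
      proof (rule Bochner_Integration.integral_cong)
        fix v :: 'a
        have e: "exp ((?h n *\<^sub>R b + l) \<bullet> v) = exp (?h n * (b \<bullet> v)) * exp (l \<bullet> v)"
          by (simp only: inner_add_left exp_add inner_scaleR_left)
        show "?q n v = real (Suc n) * (F v * exp ((?h n *\<^sub>R b + l) \<bullet> v) - F v * exp (l \<bullet> v))"
          unfolding e by (simp add: algebra_simps del: of_nat_Suc)
      qed simp
      also have "\<dots> = 0"
        by (subst integral_mult_right_zero, subst Bochner_Integration.integral_diff)
          (auto simp: zero intro!: integrable_exp_inner int)
      finally show ?thesis .
    qed
    then show ?thesis using LIMSEQ_unique[OF lim] by simp
  qed
  moreover have "(\<lambda>v. F v * (b \<bullet> v)) \<in> borel_measurable borel" by measurable
  ultimately show ?thesis by (simp add: null_laplace_def)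
qed

text \<open>A convergent sequence of arguments is bounded, which supplies the dominating function.
  This serves the continuity of choice probabilities in the covariates.\<close>

lemma continuous_laplace:
  fixes F :: "'a::euclidean_space \<Rightarrow> real"
  assumes [measurable]: "F \<in> borel_measurable borel"
    and int: "\<And>R. integrable lborel (\<lambda>v. F v * exp (R * norm v))"
  shows "continuous_on UNIV (\<lambda>l. \<integral>v. F v * exp (l \<bullet> v) \<partial>lborel)"
proof (subst continuous_on_sequentially, intro allI ballI impI, elim conjE)
  fix x :: "nat \<Rightarrow> 'a" and a assume lim: "x \<longlonglongrightarrow> a"
  obtain R where R: "\<And>n. norm (x n) \<le> R"
    using convergent_imp_Bseq[of x] lim by (auto simp: convergent_def Bseq_def)
  show "((\<lambda>l. \<integral>v. F v * exp (l \<bullet> v) \<partial>lborel) \<circ> x) \<longlonglongrightarrow> (\<integral>v. F v * exp (a \<bullet> v) \<partial>lborel)"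
    unfolding o_def
  proof (rule integral_dominated_convergence[where w="\<lambda>v. norm (F v * exp (R * norm v))"])
    show "AE v in lborel. (\<lambda>n. F v * exp (x n \<bullet> v)) \<longlonglongrightarrow> F v * exp (a \<bullet> v)"
      by (intro AE_I2 tendsto_intros lim)
    fix n
    show "AE v in lborel. norm (F v * exp (x n \<bullet> v)) \<le> norm (F v * exp (R * norm v))"
    proof (intro AE_I2)
      fix v :: 'a
      have "x n \<bullet> v \<le> norm (x n) * norm v" by (rule norm_cauchy_schwarz)
      also have "\<dots> \<le> R * norm v" using R by (intro mult_right_mono) auto
      finally show "norm (F v * exp (x n \<bullet> v)) \<le> norm (F v * exp (R * norm v))"
        by (auto simp: abs_mult intro!: mult_left_mono)
    qed
  qed (auto intro: int)
qed

text \<open>The positive and the negative part of \<open>f\<close> are densities of two measures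
  that agree on open boxes. These form an intersection-stable generator of the Borel sets, so the
  measures, and hence their densities, coincide.\<close>

lemma AE_zero_if_integral_box_zero:
  fixes f :: "'a::euclidean_space \<Rightarrow> real"
  assumes int: "integrable lborel f"
    and box: "\<And>a b. (\<integral>x. indicator (box a b) x * f x \<partial>lborel) = 0"
  shows "AE x in lborel. f x = 0"
proof -
  have [measurable]: "f \<in> borel_measurable borel"
    using int by (auto dest: borel_measurable_integrable)
  let ?E = "range (\<lambda>(a, b). box a b::'a set)"
  let ?A = "\<lambda>n::nat. box (- (real n *\<^sub>R One)) (real n *\<^sub>R One) :: 'a set"
  have fin: "(\<integral>\<^sup>+x. ennreal (g x) * indicator B x \<partial>lborel) = ennreal (\<integral>x. indicator B x * g x \<partial>lborel)"
    "integrable lborel (\<lambda>x. indicator B x * g x)"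
    if g: "integrable lborel g" "\<And>x. 0 \<le> g x" and B: "B \<in> sets borel" for g :: "'a \<Rightarrow> real" and B
  proof -
    show i: "integrable lborel (\<lambda>x. indicator B x * g x)"
      using integrable_real_mult_indicator[of B lborel g] g B by (simp add: mult.commute)
    have "(\<integral>\<^sup>+x. ennreal (g x) * indicator B x \<partial>lborel) = (\<integral>\<^sup>+x. ennreal (indicator B x * g x) \<partial>lborel)"
      by (intro nn_integral_cong) (auto simp: indicator_def)
    also have "\<dots> = ennreal (\<integral>x. indicator B x * g x \<partial>lborel)"
      using i g by (intro nn_integral_eq_integral) auto
    finally show "(\<integral>\<^sup>+x. ennreal (g x) * indicator B x \<partial>lborel) = ennreal (\<integral>x. indicator B x * g x \<partial>lborel)" .
  qed
  let ?p = "\<lambda>x. max 0 (f x)" and ?m = "\<lambda>x. max 0 (- f x)"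
  have pm: "integrable lborel ?p" "integrable lborel ?m" using int by auto
  have "density lborel ?p = density lborel ?m"
  proof (rule measure_eqI_generator_eq)
    show "Int_stable ?E" by (auto simp: Int_stable_def box_Int_box)
    show "?E \<subseteq> Pow UNIV" "sets (density lborel ?p) = sigma_sets UNIV ?E"
      "sets (density lborel ?m) = sigma_sets UNIV ?E"
      by (simp_all add: borel_eq_box)
    show "range ?A \<subseteq> ?E" "(\<Union>i. ?A i) = UNIV"
      unfolding UN_box_eq_UNIV by auto
    show "emeasure (density lborel ?p) (?A i) \<noteq> \<infinity>" for i
      using fin(1)[OF pm(1)] by (simp add: emeasure_density)
    fix X assume "X \<in> ?E"
    then obtain a b where X: "X = box a b" by auto
    have "(\<integral>x. indicator X x * ?p x \<partial>lborel) - (\<integral>x. indicator X x * ?m x \<partial>lborel)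
        = (\<integral>x. indicator X x * f x \<partial>lborel)"
    proof (subst Bochner_Integration.integral_diff[symmetric])
      show "integrable lborel (\<lambda>x. indicator X x * ?p x)" "integrable lborel (\<lambda>x. indicator X x * ?m x)"
        by (auto intro!: fin(2) pm simp: X)
      have "indicator X x * ?p x - indicator X x * ?m x = indicator X x * f x" for x
        by (simp add: indicator_def max_def)
      then show "(\<integral>x. indicator X x * ?p x - indicator X x * ?m x \<partial>lborel) = (\<integral>x. indicator X x * f x \<partial>lborel)"
        by simp
    qed
    then have "(\<integral>x. indicator X x * ?p x \<partial>lborel) = (\<integral>x. indicator X x * ?m x \<partial>lborel)"
      by (simp add: X box)
    then show "emeasure (density lborel ?p) X = emeasure (density lborel ?m) X"
      using fin(1)[OF pm(1), of X] fin(1)[OF pm(2), of X] X by (simp add: emeasure_density)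
  qed
  then have "AE x in lborel. ennreal (?p x) = ennreal (?m x)"
    by (intro sigma_finite_measure.density_unique_iff[THEN iffD1] sigma_finite_lborel) auto
  then show ?thesis
    by eventually_elim (auto simp: max_def split: if_splits)
qed

section \<open>Gaussian factors with growing exponents\<close>

text \<open>\<open>A\<close> will be an inverse covariance matrix and \<open>\<kappa>\<close> a
  lower bound of its spectrum, which lets the Gaussian factor beat every
  \<open>exp (R * norm v)\<close>.\<close>

locale gauss_form =
  fixes A :: "'a::euclidean_space \<Rightarrow> 'a" and \<kappa> :: real
  assumes lin: "linear A"
    and sym: "x \<bullet> A y = A x \<bullet> y"
    and \<kappa>: "0 < \<kappa>" "\<And>x. \<kappa> * (norm x)\<^sup>2 \<le> x \<bullet> A x"
begin

definition Q :: "'a \<Rightarrow> real" where "Q v = v \<bullet> A v"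

lemma continuous_A: "continuous_on S A"
  using lin by (simp add: linear_continuous_on linear_conv_bounded_linear)

lemma continuous_Q [continuous_intros]:
  "continuous_on S f \<Longrightarrow> continuous_on S (\<lambda>x. Q (f x))"
  unfolding Q_def
  by (intro continuous_intros continuous_on_compose2[OF continuous_A[of UNIV]]) auto

lemma measurable_A [measurable]: "A \<in> borel_measurable borel"
  by (rule borel_measurable_continuous_onI) (rule continuous_A)

lemma measurable_Q [measurable]: "Q \<in> borel_measurable borel"
  by (rule borel_measurable_continuous_onI) (intro continuous_intros)

lemma Q_lower: "\<kappa> * (norm v)\<^sup>2 \<le> Q v"
  using \<kappa> by (simp add: Q_def)

lemma Q_nonneg: "0 \<le> Q v"
  using Q_lower[of v] \<kappa>(1) by (smt (verit) mult_nonneg_nonneg zero_le_power2)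

lemma Q_scale: "Q (r *\<^sub>R v) = r\<^sup>2 * Q v"
  using lin by (simp add: Q_def linear_cmul power2_eq_square)

lemma Q_diff: "Q (v - x) = Q v - 2 * (A x \<bullet> v) + Q x"
  using lin sym[of x v] by (simp add: Q_def linear_diff inner_diff inner_commute)

text \<open>A sum of products of two linear functionals: multiplication by \<open>Q\<close> becomes
  two applications of \<open>null_laplace_mult_inner\<close> per summand.\<close>

lemma Q_eq_sum: "Q v = (\<Sum>b\<in>Basis. (b \<bullet> v) * (A b \<bullet> v))"
proof -
  have "Q v = (\<Sum>b\<in>Basis. (v \<bullet> b) * (A v \<bullet> b))"
    unfolding Q_def by (rule euclidean_inner)
  also have "\<dots> = (\<Sum>b\<in>Basis. (b \<bullet> v) * (A b \<bullet> v))"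
    by (intro sum.cong refl) (metis inner_commute sym)
  finally show ?thesis .
qed

lemma integrable_exp_Q:
  assumes c: "0 < c"
  shows "integrable lborel (\<lambda>v. exp (- c * Q v) * exp (R * norm v))"
proof -
  \<comment> \<open>Half of the quadratic decay rate \<open>c * \<kappa>\<close> is spent on
    absorbing \<open>exp (R * norm v)\<close>; completing the square costs the constant
    \<open>R\<^sup>2 / (4 * d)\<close>.\<close>
  define d where "d = c * \<kappa> / 2"
  have d: "0 < d" "c * \<kappa> = 2 * d" using c \<kappa> by (auto simp: d_def)
  have "integrable lborel (\<lambda>v::'a. exp (R\<^sup>2 / (4 * d)) * exp (- d * (norm v)\<^sup>2))"
    by (intro integrable_mult_right integrable_exp_neg_norm_square d)
  then show ?thesis
  proof (rule Bochner_Integration.integrable_bound)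
    show "AE v in lborel. norm (exp (- c * Q v) * exp (R * norm v))
        \<le> norm (exp (R\<^sup>2 / (4 * d)) * exp (- d * (norm v)\<^sup>2))"
    proof (rule AE_I2)
      fix v :: 'a
      have "c * (\<kappa> * (norm v)\<^sup>2) \<le> c * Q v"
        using Q_lower c by (intro mult_left_mono) auto
      then have 1: "2 * d * (norm v)\<^sup>2 \<le> c * Q v" using d(2) by (simp add: mult.assoc[symmetric])
      have "0 \<le> (sqrt d * norm v - R / (2 * sqrt d))\<^sup>2" by simp
      also have "\<dots> = d * (norm v)\<^sup>2 - R * norm v + R\<^sup>2 / (4 * d)"
        using d by (simp add: power2_diff power_mult_distrib power_divide field_simps)
      finally have "- c * Q v + R * norm v \<le> R\<^sup>2 / (4 * d) + - d * (norm v)\<^sup>2" using 1 by simp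
      then show "norm (exp (- c * Q v) * exp (R * norm v))
        \<le> norm (exp (R\<^sup>2 / (4 * d)) * exp (- d * (norm v)\<^sup>2))"
        by (simp add: exp_add[symmetric])
    qed
  qed measurable
qed

lemma null_laplace_mult_Q_power:
  assumes "null_laplace F"
  shows "null_laplace (\<lambda>v. F v * Q v ^ k)"
proof (induction k)
  case 0
  then show ?case using assms by simp
next
  case (Suc k)
  have "null_laplace (\<lambda>v. \<Sum>b\<in>Basis. F v * Q v ^ k * (b \<bullet> v) * (A b \<bullet> v))"
    by (intro null_laplace_sum null_laplace_mult_inner Suc)
  also have "(\<lambda>v. \<Sum>b\<in>Basis. F v * Q v ^ k * (b \<bullet> v) * (A b \<bullet> v)) = (\<lambda>v. F v * Q v ^ Suc k)"
  proof (rule ext)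
    fix v
    have "(\<Sum>b\<in>Basis. F v * Q v ^ k * (b \<bullet> v) * (A b \<bullet> v))
        = F v * Q v ^ k * (\<Sum>b\<in>Basis. (b \<bullet> v) * (A b \<bullet> v))"
      by (simp only: sum_distrib_left mult.assoc)
    then show "(\<Sum>b\<in>Basis. F v * Q v ^ k * (b \<bullet> v) * (A b \<bullet> v)) = F v * Q v ^ Suc k"
      by (simp add: Q_eq_sum[symmetric])
  qed
  finally show ?case .
qed

text \<open>The integral \<open>\<integral>g exp(-c Q) exp(l\<cdot>v) dv\<close> is analytic in \<open>c\<close> with all derivatives at \<open>c\<close>
  vanishing, and its Taylor series at \<open>c\<close> converges as long as \<open>c' < 2c\<close>.\<close>

lemma null_laplace_extend:
  assumes g[measurable]: "g \<in> borel_measurable borel" and bounded: "AE v in lborel. \<bar>g v\<bar> \<le> 1"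
    and null: "null_laplace (\<lambda>v. g v * exp (- c * Q v))"
    and c: "0 < c" "c \<le> c'" "c' < 2 * c"
  shows "null_laplace (\<lambda>v. g v * exp (- c' * Q v))"
proof -
  define d where "d = c' - c"
  have d: "0 \<le> d" "d < c" using c by (auto simp: d_def)
  have int: "integrable lborel (\<lambda>v. g v * exp (- a * Q v) * exp (R * norm v))" if "0 < a" for a R
  proof (rule Bochner_Integration.integrable_bound[OF integrable_exp_Q[OF that, of R]])
    show "AE v in lborel. norm (g v * exp (- a * Q v) * exp (R * norm v)) \<le> norm (exp (- a * Q v) * exp (R * norm v))"
      using bounded by eventually_elim (auto simp: abs_mult mult_left_le_one_le)
  qed measurable
  have "(\<integral>v. g v * exp (- c' * Q v) * exp (l \<bullet> v) \<partial>lborel) = 0" for l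
  proof -
    let ?p = "\<lambda>n v. \<Sum>k<n. (- d * Q v) ^ k / fact k"
    have lim: "(\<lambda>n. \<integral>v. g v * exp (- c * Q v) * ?p n v * exp (l \<bullet> v) \<partial>lborel)
        \<longlonglongrightarrow> (\<integral>v. g v * exp (- c * Q v) * exp (- d * Q v) * exp (l \<bullet> v) \<partial>lborel)"
    \<comment> \<open>The partial sums of \<open>exp (- d * Q v)\<close> are only bounded by
      \<open>exp (d * Q v)\<close>. The dominating function is integrable because
      \<open>d < c\<close>, which is where \<open>c' < 2 * c\<close> enters.\<close>
    proof (rule integral_dominated_convergence[where w="\<lambda>v. norm (exp (- (c - d) * Q v) * exp (norm l * norm v))"])
      show "integrable lborel (\<lambda>v. norm (exp (- (c - d) * Q v) * exp (norm l * norm v)))"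
        using d by (intro integrable_norm integrable_exp_Q) auto
      show "AE v in lborel. (\<lambda>n. g v * exp (- c * Q v) * ?p n v * exp (l \<bullet> v))
          \<longlonglongrightarrow> g v * exp (- c * Q v) * exp (- d * Q v) * exp (l \<bullet> v)"
      proof (intro AE_I2 tendsto_intros)
        fix v
        show "(\<lambda>n. ?p n v) \<longlonglongrightarrow> exp (- d * Q v)"
          using exp_converges[of "- d * Q v"] by (simp add: sums_def divide_inverse mult.commute)
      qed
      fix n
      show "AE v in lborel. norm (g v * exp (- c * Q v) * ?p n v * exp (l \<bullet> v))
          \<le> norm (exp (- (c - d) * Q v) * exp (norm l * norm v))"
        using bounded
      proof eventually_elim
        fix v assume gv: "\<bar>g v\<bar> \<le> 1"
        have "\<bar>?p n v\<bar> \<le> (\<Sum>k<n. \<bar>(- d * Q v) ^ k / fact k\<bar>)" by (rule sum_abs)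
        also have "\<dots> = (\<Sum>k<n. (d * Q v) ^ k / fact k)"
          using d Q_nonneg[of v] by (intro sum.cong refl) (simp add: power_abs[symmetric] abs_mult)
        also have "\<dots> \<le> (\<Sum>k. (d * Q v) ^ k / fact k)"
          using summable_exp[of "d * Q v"] d Q_nonneg[of v]
          by (intro sum_le_suminf) (auto simp: divide_inverse mult.commute)
        also have "\<dots> = exp (d * Q v)" by (simp add: exp_def divide_inverse mult.commute)
        finally have p: "\<bar>?p n v\<bar> \<le> exp (d * Q v)" .
        have "norm (g v * exp (- c * Q v) * ?p n v * exp (l \<bullet> v))
            = \<bar>g v\<bar> * exp (- c * Q v) * \<bar>?p n v\<bar> * exp (l \<bullet> v)"
          by (simp only: real_norm_def abs_mult abs_exp_cancel)
        also have "\<dots> \<le> 1 * exp (- c * Q v) * exp (d * Q v) * exp (norm l * norm v)"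
          using gv p norm_cauchy_schwarz[of l v] by (intro mult_mono) auto
        also have "\<dots> = norm (exp (- (c - d) * Q v) * exp (norm l * norm v))"
          by (simp add: exp_add[symmetric] algebra_simps)
        finally show "norm (g v * exp (- c * Q v) * ?p n v * exp (l \<bullet> v))
          \<le> norm (exp (- (c - d) * Q v) * exp (norm l * norm v))" .
      qed
    qed measurable
    have "(\<integral>v. g v * exp (- c * Q v) * ?p n v * exp (l \<bullet> v) \<partial>lborel) = 0" for n
    proof -
      \<comment> \<open>A partial sum is a finite combination of \<open>Q v ^ k\<close> times the
        given null function.\<close>
      have "null_laplace (\<lambda>v. \<Sum>k<n. (- d) ^ k / fact k * (g v * exp (- c * Q v) * Q v ^ k))"
        by (intro null_laplace_sum null_laplace_cmult null_laplace_mult_Q_power null)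
      also have "(\<lambda>v. \<Sum>k<n. (- d) ^ k / fact k * (g v * exp (- c * Q v) * Q v ^ k))
          = (\<lambda>v. g v * exp (- c * Q v) * ?p n v)"
      proof (rule ext)
        fix v
        have "(- d) ^ k / fact k * (g v * exp (- c * Q v) * Q v ^ k)
            = g v * exp (- c * Q v) * ((- d * Q v) ^ k / fact k)" for k
          by (subst power_mult_distrib) (simp only: divide_inverse mult_ac)
        then show "(\<Sum>k<n. (- d) ^ k / fact k * (g v * exp (- c * Q v) * Q v ^ k))
            = g v * exp (- c * Q v) * ?p n v"
          by (simp only: sum_distrib_left)
      qed
      finally show ?thesis by (simp add: null_laplace_def)
    qed
    then have "(\<integral>v. g v * exp (- c * Q v) * exp (- d * Q v) * exp (l \<bullet> v) \<partial>lborel) = 0"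
      using LIMSEQ_unique[OF lim] by simp
    moreover have "g v * exp (- c * Q v) * exp (- d * Q v) = g v * exp (- c' * Q v)" for v
      by (simp add: d_def mult.assoc exp_add[symmetric]) (simp add: algebra_simps)
    ultimately show ?thesis by (simp only:)
  qed
  then show ?thesis
    using int c by (auto simp: null_laplace_def)
qed

text \<open>One extension step cannot double the exponent, but a fixed ratio strictly between 1 and
  2 can be iterated and drives the exponent to infinity.\<close>

lemma null_laplace_extend_all:
  assumes g[measurable]: "g \<in> borel_measurable borel" and bounded: "AE v in lborel. \<bar>g v\<bar> \<le> 1"
    and null: "null_laplace (\<lambda>v. g v * exp (- c * Q v))"
    and c: "0 < c"
  shows "null_laplace (\<lambda>v. g v * exp (- (c * (3/2) ^ m) * Q v))"
proof (induction m)
  case 0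
  then show ?case using null by simp
next
  case (Suc m)
  show ?case
    by (rule null_laplace_extend[OF g bounded Suc]) (use c in \<open>auto simp: field_simps\<close>)
qed

text \<open>The surplus exponent serves as a kernel \<open>exp (- s m * Q (v - x))\<close> around
  \<open>x\<close>; expanding the square shows that its integral against \<open>\<psi>\<close> is a
  Laplace transform known to vanish. Integrating over \<open>x\<close> in a box and letting the
  kernel shrink shows that \<open>\<psi>\<close> integrates to zero over the box.\<close>

lemma null_laplace_imp_AE_zero:
  assumes g[measurable]: "g \<in> borel_measurable borel" and bounded: "AE v in lborel. \<bar>g v\<bar> \<le> 1"
    and null: "null_laplace (\<lambda>v. g v * exp (- c * Q v))"
    and c: "0 < c"
  shows "AE v in lborel. g v = 0"
proof -
  define \<psi> where "\<psi> v = g v * exp (- c * Q v)" for v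
  have [measurable]: "\<psi> \<in> borel_measurable borel" unfolding \<psi>_def by measurable
  have int\<psi>: "integrable lborel \<psi>"
    using null[unfolded null_laplace_def, THEN conjunct2, THEN conjunct1, rule_format, of 0]
    by (simp add: \<psi>_def[abs_def])
  \<comment> \<open>The exponent gained over \<open>c\<close>; starting at \<open>Suc m\<close>
    keeps it positive for \<open>m = 0\<close>.\<close>
  define s where "s m = c * (3/2) ^ Suc m - c" for m
  have s: "0 < s m" for m
  proof -
    have "1 < (3/2::real) ^ Suc m" by (rule power_gt1) simp
    then show ?thesis using c by (simp add: s_def)
  qed
  \<comment> \<open>The width of the kernel: substituting \<open>x = v + r m *\<^sub>R y\<close>
    turns \<open>s m * Q (v - x)\<close> into \<open>Q y\<close>.\<close>
  define r where "r m = 1 / sqrt (s m)" for m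
  have r: "0 < r m" "s m * (r m)\<^sup>2 = 1" for m
    using s[of m] by (auto simp: r_def power_divide)
  have r0: "r \<longlonglongrightarrow> 0"
  proof -
    have "filterlim (\<lambda>m. (3/2::real) ^ Suc m - 1) at_top sequentially" by real_asymp
    then have "filterlim (\<lambda>m. c * ((3/2::real) ^ Suc m - 1)) at_top sequentially"
      by (rule filterlim_tendsto_pos_mult_at_top[OF tendsto_const c])
    then have "filterlim (\<lambda>m. sqrt (s m)) at_top sequentially"
      unfolding s_def by (intro filterlim_compose[OF sqrt_at_top]) (simp add: right_diff_distrib)
    then show ?thesis
      unfolding r_def by (intro tendsto_divide_0[OF tendsto_const] filterlim_at_top_imp_at_infinity)
  qed
  have conv0: "(\<integral>v. \<psi> v * exp (- s m * Q (v - x)) \<partial>lborel) = 0" for m x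
  proof -
    have "(\<integral>v. \<psi> v * exp (- s m * Q (v - x)) \<partial>lborel)
        = (\<integral>v. exp (- s m * Q x) * (g v * exp (- (c * (3/2) ^ Suc m) * Q v) * exp (((2 * s m) *\<^sub>R A x) \<bullet> v)) \<partial>lborel)"
    proof (intro Bochner_Integration.integral_cong refl)
      fix v
      define K where "K = c * (3/2) ^ Suc m"
      have K: "s m = K - c" by (simp add: s_def K_def)
      show "\<psi> v * exp (- s m * Q (v - x))
          = exp (- s m * Q x) * (g v * exp (- (c * (3/2) ^ Suc m) * Q v) * exp (((2 * s m) *\<^sub>R A x) \<bullet> v))"
        unfolding K_def[symmetric] K by (simp add: \<psi>_def Q_diff exp_add[symmetric] algebra_simps)
    qed
    also have "\<dots> = 0"
      using null_laplace_extend_all[OF g bounded null c, of "Suc m"]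
      by (simp only: integral_mult_right_zero null_laplace_def mult_zero_right)
    finally show ?thesis .
  qed
  define k where "k y = exp (- Q y)" for y
  have [measurable]: "k \<in> borel_measurable borel" unfolding k_def by measurable
  have intk: "integrable lborel k" using integrable_exp_Q[of 1 0] by (simp add: k_def[abs_def])
  have kpos: "0 < (\<integral>y. k y \<partial>lborel)"
  proof -
    have "(\<integral>y. k y \<partial>lborel) \<noteq> 0"
    proof
      assume "(\<integral>y. k y \<partial>lborel) = 0"
      then have "AE y in lborel. k y = 0"
        using intk by (subst (asm) integral_nonneg_eq_0_iff_AE) (auto simp: k_def)
      then show False using open_AE_lborel_nonempty[of "\<lambda>y. k y = 0" UNIV] by (auto simp: k_def)
    qed
    moreover have "0 \<le> (\<integral>y. k y \<partial>lborel)" by (intro Bochner_Integration.integral_nonneg) (simp add: k_def)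
    ultimately show ?thesis by simp
  qed
  have "(\<integral>v. indicator (box a b) v * \<psi> v \<partial>lborel) = 0" for a b
  proof -
    let ?I = "indicator (box a b) :: 'a \<Rightarrow> real"
    \<comment> \<open>The box indicator smoothed at scale \<open>r m\<close>, written with the fixed
      kernel \<open>k\<close> so that the limit in \<open>m\<close> concerns only the
      indicator.\<close>
    define J where "J m v = (\<integral>y. ?I (v + r m *\<^sub>R y) * k y \<partial>lborel)" for m v
    have meas_Ik: "(\<lambda>y. ?I (v + t *\<^sub>R y) * k y) \<in> borel_measurable borel" for v t
      by measurable
    have J_bound: "norm (J m v) \<le> (\<integral>y. k y \<partial>lborel)" for m v
      unfolding J_def
      by (rule Bochner_Integration.integral_norm_bound_integral) (auto simp: intk k_def indicator_def
            intro!: Bochner_Integration.integrable_bound[OF intk] meas_Ik)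
    have J_meas[measurable]: "J m \<in> borel_measurable borel" for m
      unfolding J_def[abs_def] by measurable
    have J0: "(\<integral>v. \<psi> v * J m v \<partial>lborel) = 0" for m
    proof -
      define G where "G v x = ?I x * exp (- s m * Q (v - x))" for v x
      have [measurable]: "(\<lambda>(v, x). \<psi> v * G v x) \<in> borel_measurable (lborel \<Otimes>\<^sub>M lborel)"
        unfolding G_def by measurable
      have GJ: "(\<integral>x. G v x \<partial>lborel) = r m ^ DIM('a) * J m v" for v
      proof -
        have "(\<integral>x. G v x \<partial>lborel) = \<bar>r m\<bar> ^ DIM('a) * (\<integral>y. G v (v + r m *\<^sub>R y) \<partial>lborel)"
          by (rule lborel_integral_affine) (use r[of m] in \<open>auto simp: G_def[abs_def]\<close>)
        also have "(\<integral>y. G v (v + r m *\<^sub>R y) \<partial>lborel) = J m v"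
        proof -
          have "s m * Q (v - (v + r m *\<^sub>R y)) = Q y" for y
          proof -
            have "s m * Q (v - (v + r m *\<^sub>R y)) = s m * Q ((- r m) *\<^sub>R y)" by simp
            also have "\<dots> = (s m * (r m)\<^sup>2) * Q y" by (subst Q_scale) simp
            finally show ?thesis by (simp only: r(2) mult_1)
          qed
          then show ?thesis
            unfolding J_def k_def G_def by (simp only: mult_minus_left)
        qed
        finally show ?thesis using r(1)[of m] by simp
      qed
      have intI: "integrable lborel ?I"
        using emeasure_lborel_box_finite[of a b] by (simp add: integrable_indicator_iff)
      have intprod: "integrable (lborel \<Otimes>\<^sub>M lborel) (\<lambda>(v, x). \<psi> v * G v x)"
      proof (rule Bochner_Integration.integrable_bound)
        show "integrable (lborel \<Otimes>\<^sub>M lborel) (\<lambda>(v, x). \<psi> v * ?I x)"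
          using int\<psi> intI
          by (intro lborel_pair.Fubini_integrable) (auto simp: abs_mult)
        show "AE p in lborel \<Otimes>\<^sub>M lborel. norm (case p of (v, x) \<Rightarrow> \<psi> v * G v x)
            \<le> norm (case p of (v, x) \<Rightarrow> \<psi> v * ?I x)"
          using s[of m] Q_nonneg
          by (intro AE_I2) (auto simp: abs_mult indicator_def G_def mult_left_le)
      qed measurable
      \<comment> \<open>Up to the Jacobian \<open>r m ^ DIM('a)\<close> this is a double integral of
        \<open>\<psi> v * G v x\<close>; in the other order its inner integral vanishes by
        \<open>conv0\<close>.\<close>
      have "r m ^ DIM('a) * (\<integral>v. \<psi> v * J m v \<partial>lborel) = (\<integral>v. \<psi> v * (r m ^ DIM('a) * J m v) \<partial>lborel)"
        by (subst Bochner_Integration.integral_mult_right_zero[symmetric]) (simp only: mult.left_commute)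
      also have "\<dots> = (\<integral>v. (\<integral>x. \<psi> v * G v x \<partial>lborel) \<partial>lborel)"
        by (simp add: GJ)
      also have "\<dots> = (\<integral>x. (\<integral>v. \<psi> v * G v x \<partial>lborel) \<partial>lborel)"
        by (rule lborel_pair.Fubini_integral[OF intprod, symmetric])
      also have "\<dots> = (\<integral>x. ?I x * (\<integral>v. \<psi> v * exp (- s m * Q (v - x)) \<partial>lborel) \<partial>lborel)"
      proof (rule Bochner_Integration.integral_cong)
        fix x
        have "(\<integral>v. \<psi> v * G v x \<partial>lborel) = (\<integral>v. ?I x * (\<psi> v * exp (- s m * Q (v - x))) \<partial>lborel)"
          by (simp only: G_def mult.left_commute)
        then show "(\<integral>v. \<psi> v * G v x \<partial>lborel) = ?I x * (\<integral>v. \<psi> v * exp (- s m * Q (v - x)) \<partial>lborel)"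
          by (simp only: Bochner_Integration.integral_mult_right_zero)
      qed simp
      also have "\<dots> = 0" by (simp only: conv0) simp
      finally show ?thesis using r(1)[of m] by simp
    qed
    \<comment> \<open>Off the boundary of the box, a null set, the indicator is locally constant, so
      the smoothed indicators converge.\<close>
    have "AE v in lborel. v \<notin> cbox a b - box a b"
    proof (rule AE_not_in)
      have "cbox a b - box a b \<in> null_sets (completion lborel)"
        using negligible_frontier_interval negligible_iff_null_sets by blast
      then show "cbox a b - box a b \<in> null_sets lborel"
        by (subst (asm) null_sets_completion_iff) auto
    qed
    then have J_lim: "AE v in lborel. (\<lambda>m. J m v) \<longlonglongrightarrow> ?I v * (\<integral>y. k y \<partial>lborel)"
    proof eventually_elim
      fix v assume v: "v \<notin> cbox a b - box a b"
      have ev: "\<forall>\<^sub>F m in sequentially. ?I (v + r m *\<^sub>R y) = ?I v" for y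
      proof -
        have t: "(\<lambda>m. v + r m *\<^sub>R y) \<longlonglongrightarrow> v" by (rule tendsto_eq_intros r0 | simp)+
        show ?thesis
        proof (cases "v \<in> box a b")
          case True
          then show ?thesis
            using topological_tendstoD[OF t open_box True] by (auto elim!: eventually_mono)
        next
          case False
          then have "v \<in> - cbox a b" using v by auto
          then have "\<forall>\<^sub>F m in sequentially. v + r m *\<^sub>R y \<in> - cbox a b"
            by (intro topological_tendstoD[OF t]) (auto simp: open_Compl closed_cbox)
          then show ?thesis
            by (rule eventually_mono) (use False box_subset_cbox[of a b] in \<open>auto simp: indicator_def\<close>)
        qed
      qed
      have "(\<lambda>m. J m v) \<longlonglongrightarrow> (\<integral>y. ?I v * k y \<partial>lborel)"
        unfolding J_def
      proof (rule integral_dominated_convergence[where w=k])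
        show "AE y in lborel. (\<lambda>m. ?I (v + r m *\<^sub>R y) * k y) \<longlonglongrightarrow> ?I v * k y"
          by (intro AE_I2 tendsto_mult tendsto_const tendsto_eventually ev)
        show "AE y in lborel. norm (?I (v + r m *\<^sub>R y) * k y) \<le> k y" for m
          by (auto simp: k_def indicator_def)
      qed (auto simp: intk)
      then show "(\<lambda>m. J m v) \<longlonglongrightarrow> ?I v * (\<integral>y. k y \<partial>lborel)" by simp
    qed
    have "(\<lambda>m. \<integral>v. \<psi> v * J m v \<partial>lborel) \<longlonglongrightarrow> (\<integral>v. \<psi> v * (?I v * (\<integral>y. k y \<partial>lborel)) \<partial>lborel)"
    proof (rule integral_dominated_convergence[where w="\<lambda>v. norm (\<psi> v) * (\<integral>y. k y \<partial>lborel)"])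
      show "AE v in lborel. (\<lambda>m. \<psi> v * J m v) \<longlonglongrightarrow> \<psi> v * (?I v * (\<integral>y. k y \<partial>lborel))"
        using J_lim by eventually_elim (intro tendsto_intros)
      show "AE v in lborel. norm (\<psi> v * J m v) \<le> norm (\<psi> v) * (\<integral>y. k y \<partial>lborel)" for m
        using J_bound[of m] by (intro AE_I2) (auto simp: abs_mult intro!: mult_left_mono)
      show "integrable lborel (\<lambda>v. norm (\<psi> v) * (\<integral>y. k y \<partial>lborel))"
        using int\<psi> by simp
    qed measurable
    then have "(\<integral>v. \<psi> v * (?I v * (\<integral>y. k y \<partial>lborel)) \<partial>lborel) = 0"
      by (simp only: J0) (simp add: LIMSEQ_const_iff)
    then have "(\<integral>v. (?I v * \<psi> v) * (\<integral>y. k y \<partial>lborel) \<partial>lborel) = 0"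
      by (simp only: mult_ac)
    then show ?thesis using kpos by simp
  qed
  then have "AE v in lborel. \<psi> v = 0"
    by (rule AE_zero_if_integral_box_zero[OF int\<psi>])
  then show ?thesis by (simp add: \<psi>_def)
qed

end

section \<open>The multivariate normal distribution\<close>

lemma pos_def_injective:
  assumes "pos_def (S :: real^'i::finite^'i)" "S *v x = 0"
  shows "x = 0"
  using assms by (force simp: pos_def_def)

lemma pos_def_invertible: "pos_def (S :: real^'i::finite^'i) \<Longrightarrow> invertible S"
  by (auto simp: invertible_left_inverse matrix_left_invertible_ker dest: pos_def_injective)

lemma pos_def_inverse:
  assumes "pos_def (S :: real^'i::finite^'i)"
  shows "S *v (matrix_inv S *v x) = x" "matrix_inv S *v (S *v x) = x"
proof -
  have "S ** matrix_inv S = mat 1 \<and> matrix_inv S ** S = mat 1"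
    using pos_def_invertible[OF assms] unfolding invertible_def matrix_inv_def by (rule someI_ex)
  then show "S *v (matrix_inv S *v x) = x" "matrix_inv S *v (S *v x) = x"
    by (simp_all add: matrix_vector_mul_assoc)
qed

lemma pos_def_symmetric:
  assumes "pos_def (S :: real^'i::finite^'i)"
  shows "x \<bullet> (S *v y) = (S *v x) \<bullet> y"
proof -
  have "x \<bullet> (S *v y) = (x v* S) \<bullet> y" by (rule dot_lmul_matrix[symmetric])
  also have "x v* S = transpose S *v x" by simp
  also have "transpose S = S" using assms by (simp add: pos_def_def)
  finally show ?thesis .
qed

text \<open>On the segment from the identity to \<open>S\<close> every matrix is positive definite,
  hence invertible, so the determinant cannot change sign on the way from
  \<open>det (mat 1) = 1\<close>.\<close>

lemma pos_def_det_pos: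
  assumes S: "pos_def (S :: real^'i::finite^'i)"
  shows "0 < det S"
proof (rule ccontr)
  assume neg: "\<not> 0 < det S"
  define M where "M t = t *\<^sub>R S + (1 - t) *\<^sub>R mat 1" for t :: real
  have "continuous_on {0..1} (\<lambda>t. det (M t))"
    unfolding det_def M_def by (auto intro!: continuous_intros)
  moreover have "det (M 1) \<le> 0" "0 \<le> det (M 0)" using neg by (auto simp: M_def)
  ultimately obtain t where t: "0 \<le> t" "t \<le> 1" "det (M t) = 0"
    using IVT2'[of "\<lambda>t. det (M t)" 1 0 0] by auto
  have "pos_def (M t)"
    unfolding pos_def_def
  proof (intro conjI allI impI)
    have "transpose S = S" using S by (simp add: pos_def_def)
    then have "S $ i $ j = S $ j $ i" for i j by (metis transpose_def vec_lambda_beta)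
    then show "transpose (M t) = M t"
      by (simp add: vec_eq_iff transpose_def M_def mat_def)
    fix v :: "real^'i" assume v: "v \<noteq> 0"
    have "v \<bullet> (M t *v v) = t * (v \<bullet> (S *v v)) + (1 - t) * (v \<bullet> v)"
      by (simp add: M_def matrix_vector_mult_add_rdistrib scaleR_matrix_vector_assoc[symmetric] inner_add_right)
    moreover have "0 < v \<bullet> (S *v v)" "0 < v \<bullet> v" using S v by (auto simp: pos_def_def)
    ultimately show "0 < v \<bullet> (M t *v v)"
      using t by (cases "t = 0") (auto intro!: add_pos_nonneg)
  qed
  then have "invertible (M t)" by (rule pos_def_invertible)
  then show False using t by (simp add: invertible_det_nz)
qed

text \<open>The constant is the minimum of the inverse quadratic form on the unit sphere, positive
  by compactness; homogeneity extends the bound to all vectors.\<close>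

lemma pos_def_gauss_form:
  assumes S: "pos_def (S :: real^'i::finite^'i)"
  obtains \<kappa> where "gauss_form ((*v) (matrix_inv S)) \<kappa>"
proof -
  let ?P = "(*v) (matrix_inv S)"
  have sym: "x \<bullet> ?P y = ?P x \<bullet> y" for x y
    using pos_def_symmetric[OF S, of "?P x" "?P y"] by (simp add: pos_def_inverse[OF S])
  have pos: "0 < x \<bullet> ?P x" if "x \<noteq> 0" for x
  proof -
    have "?P x \<noteq> 0" using that pos_def_inverse(1)[OF S, of x] by auto
    then have "0 < ?P x \<bullet> (S *v ?P x)" using S unfolding pos_def_def by blast
    then show ?thesis by (simp add: pos_def_inverse[OF S] inner_commute)
  qed
  let ?K = "sphere (0::real^'i) 1"
  have "continuous_on ?K (\<lambda>x. x \<bullet> ?P x)"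
    by (intro continuous_intros linear_continuous_on) (simp add: linear_conv_bounded_linear[symmetric])
  moreover have "?K \<noteq> {}" using vector_choose_size[of 1] by auto
  ultimately obtain u where u: "u \<in> ?K" "\<And>x. x \<in> ?K \<Longrightarrow> u \<bullet> ?P u \<le> x \<bullet> ?P x"
    using continuous_attains_inf[of ?K "\<lambda>x. x \<bullet> ?P x"] by auto
  have "gauss_form ?P (u \<bullet> ?P u)"
  proof (rule gauss_form.intro)
    show "linear ?P" by simp
    show "x \<bullet> ?P y = ?P x \<bullet> y" for x y by (rule sym)
    show "0 < u \<bullet> ?P u" using u(1) by (intro pos) auto
    fix x :: "real^'i"
    show "u \<bullet> ?P u * (norm x)\<^sup>2 \<le> x \<bullet> ?P x"
    proof (cases "x = 0")
      case False
      let ?y = "(1 / norm x) *\<^sub>R x"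
      have "u \<bullet> ?P u \<le> ?y \<bullet> ?P ?y" using False by (intro u(2)) simp
      also have "\<dots> = (x \<bullet> ?P x) / (norm x)\<^sup>2"
        by (simp add: matrix_vector_mult_scaleR power2_eq_square)
      finally show ?thesis using False by (simp add: field_simps)
    qed simp
  qed
  then show ?thesis by (rule that)
qed

section \<open>Density, null sets and shifts of the normal law\<close>

definition gauss_const :: "real^'i::finite^'i \<Rightarrow> real" where
  "gauss_const S = 1 / sqrt ((2 * pi) ^ CARD('i) * det S)"

lemma gauss_const_pos: "pos_def S \<Longrightarrow> 0 < gauss_const S"
  using pos_def_det_pos[of S] by (simp add: gauss_const_def)

lemma gauss_density_eq:
  "gauss_density S e = gauss_const S * exp (- (e \<bullet> (matrix_inv S *v e)) / 2)"
  by (simp add: gauss_density_def gauss_const_def)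

lemma gauss_density_pos: "pos_def S \<Longrightarrow> 0 < gauss_density S e"
  by (simp add: gauss_density_eq gauss_const_pos)

lemma measurable_gauss_density [measurable]: "gauss_density S \<in> borel_measurable borel"
proof -
  have "continuous_on UNIV (\<lambda>e. matrix_inv S *v e)"
    by (simp add: linear_continuous_on linear_conv_bounded_linear[symmetric])
  then have "continuous_on UNIV (gauss_density S)"
    unfolding gauss_density_eq[abs_def] by (intro continuous_intros) auto
  then show ?thesis by (rule borel_measurable_continuous_onI)
qed

lemma integrable_gauss_density:
  assumes "pos_def S" shows "integrable lborel (gauss_density S)"
proof -
  obtain \<kappa> where "gauss_form ((*v) (matrix_inv S)) \<kappa>" using pos_def_gauss_form[OF assms] .
  then interpret gauss_form "(*v) (matrix_inv S)" \<kappa> .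
  show ?thesis
    using integrable_exp_Q[of "1/2" 0] by (simp add: gauss_density_eq[abs_def] Q_def)
qed

lemma sets_mvnormal [simp, measurable_cong]: "sets (mvnormal S) = sets borel"
  and space_mvnormal [simp]: "space (mvnormal S) = UNIV"
  by (simp_all add: mvnormal_def)

lemma finite_measure_mvnormal:
  assumes "pos_def S" shows "finite_measure (mvnormal S)"
proof
  have "(\<integral>\<^sup>+e. ennreal (gauss_density S e) \<partial>lborel) < \<infinity>"
    using integrable_gauss_density[OF assms] gauss_density_pos[OF assms]
    unfolding integrable_iff_bounded by (simp add: less_imp_le)
  then show "emeasure (mvnormal S) (space (mvnormal S)) \<noteq> \<infinity>"
    by (simp add: mvnormal_def emeasure_density)
qed

text \<open>The density is positive everywhere. Almost sure statements about the shocks can thus be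
  phrased with \<open>lborel\<close>, whatever the covariance matrix.\<close>

lemma AE_mvnormal_iff:
  assumes "pos_def S" shows "(AE e in mvnormal S. P e) \<longleftrightarrow> (AE e in lborel. P e)"
  unfolding mvnormal_def by (subst AE_density) (auto simp: gauss_density_pos[OF assms])

lemma emeasure_mvnormal_open_pos:
  assumes "pos_def S" "open U" "U \<noteq> {}" shows "0 < emeasure (mvnormal S) U"
proof (rule ccontr)
  assume "\<not> ?thesis"
  then have "U \<in> null_sets (mvnormal S)" using assms by (auto simp: null_sets_def)
  then have "AE e in lborel. e \<notin> U" using AE_mvnormal_iff[OF assms(1)] by (metis AE_not_in)
  then show False using open_AE_lborel_nonempty[of "\<lambda>e. e \<notin> U" U] assms by auto
qed

text \<open>Writing the shift as \<open>S *v l\<close> cancels the inverse covariance in the cross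
  term and leaves \<open>l \<bullet> e\<close>, so tail estimates never need entries of the
  inverse.\<close>

lemma cameron_martin_mvnormal:
  fixes S :: "real^'i::finite^'i"
  assumes S: "pos_def S" and [measurable]: "f \<in> borel_measurable borel"
  shows "(\<integral>\<^sup>+e. f e \<partial>mvnormal S)
    = (\<integral>\<^sup>+e. f (e + S *v l) * ennreal (exp (- (l \<bullet> e) - (l \<bullet> (S *v l)) / 2)) \<partial>mvnormal S)"
proof -
  have dens: "gauss_density S (e + S *v l) = gauss_density S e * exp (- (l \<bullet> e) - (l \<bullet> (S *v l)) / 2)" for e
  proof -
    have "(e + S *v l) \<bullet> (matrix_inv S *v (e + S *v l)) = (e + S *v l) \<bullet> (matrix_inv S *v e + l)"
      by (simp add: matrix_vector_right_distrib pos_def_inverse[OF S])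
    also have "(S *v l) \<bullet> (matrix_inv S *v e) = l \<bullet> e"
      by (simp add: pos_def_symmetric[OF S, symmetric] pos_def_inverse[OF S])
    then have "(e + S *v l) \<bullet> (matrix_inv S *v e + l) = e \<bullet> (matrix_inv S *v e) + 2 * (l \<bullet> e) + l \<bullet> (S *v l)"
      by (simp add: inner_add inner_commute)
    finally show ?thesis
      by (simp add: gauss_density_eq exp_add[symmetric] field_simps)
  qed
  have "(\<integral>\<^sup>+e. f e \<partial>mvnormal S) = (\<integral>\<^sup>+e. ennreal (gauss_density S e) * f e \<partial>lborel)"
    unfolding mvnormal_def by (rule nn_integral_density) measurable
  also have "\<dots> = (\<integral>\<^sup>+e. ennreal (gauss_density S (e + S *v l)) * f (e + S *v l) \<partial>lborel)"
    by (rule nn_integral_lborel_translate[symmetric]) measurable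
  also have "\<dots> = (\<integral>\<^sup>+e. ennreal (gauss_density S e) * (f (e + S *v l) * ennreal (exp (- (l \<bullet> e) - (l \<bullet> (S *v l)) / 2))) \<partial>lborel)"
    by (intro nn_integral_cong) (simp add: dens ennreal_mult less_imp_le[OF gauss_density_pos[OF S]] mult_ac)
  also have "\<dots> = (\<integral>\<^sup>+e. f (e + S *v l) * ennreal (exp (- (l \<bullet> e) - (l \<bullet> (S *v l)) / 2)) \<partial>mvnormal S)"
    unfolding mvnormal_def by (rule nn_integral_density[symmetric]) measurable
  finally show ?thesis .
qed

text \<open>Both bounds come from shifting by the conditional mean of the shocks given \<open>e\<^sub>i = e\<^sub>j = -s\<close>.\<close>

lemma mvnormal_orthant_tail:
  fixes S :: "real^'i::finite^'i" and i j :: 'i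
  assumes S: "pos_def S" and diag: "\<And>k. S $ k $ k = 1"
  defines "\<rho> \<equiv> S $ i $ j"
  shows "\<rho> > -1"
    and "\<exists>k>0. \<forall>s\<ge>0. k * exp (- s\<^sup>2 / (1 + \<rho>) - 2 * s / (1 + \<rho>)) \<le> measure (mvnormal S) {e. e $ i < - s \<and> e $ j < - s}"
    and "\<exists>k>0. \<forall>s\<ge>0. measure (mvnormal S) {e. e $ i \<le> - s \<and> e $ j \<le> - s} \<le> k * exp (- s\<^sup>2 / (1 + \<rho>))"
proof -
  interpret finite_measure "mvnormal S" by (rule finite_measure_mvnormal[OF S])
  \<comment> \<open>The sum \<open>e $ i + e $ j\<close> is \<open>c \<bullet> e\<close>, with
    variance \<open>2 * (1 + \<rho>)\<close>. For \<open>i = j\<close> the vector is twice a basis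
    vector and the same formulas hold with \<open>\<rho> = 1\<close>.\<close>
  define c :: "real^'i" where "c = axis i 1 + axis j 1"
  have tr: "S $ a $ b = S $ b $ a" for a b
    using S unfolding pos_def_def transpose_def by (metis vec_lambda_beta)
  have Sc: "(S *v c) $ k = S $ k $ i + S $ k $ j" for k
    by (simp add: c_def matrix_vector_right_distrib matrix_vector_mult_basis column_def)
  have cc: "c \<bullet> (S *v c) = 2 * (1 + \<rho>)"
    using Sc[of i] Sc[of j] tr[of i j] diag by (simp add: c_def inner_add_left inner_axis' \<rho>_def)
  have ce: "c \<bullet> e = e $ i + e $ j" for e by (simp add: c_def inner_add_left inner_axis')
  have "c \<noteq> 0"
    by (auto simp: c_def vec_eq_iff axis_def intro!: exI[of _ i])
  then have "0 < 2 * (1 + \<rho>)" using S unfolding cc[symmetric] pos_def_def by blast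
  then show \<rho>: "\<rho> > -1" by simp
  have shift: "emeasure (mvnormal S) B = ennreal (exp (- s\<^sup>2 / (1 + \<rho>))) *
      (\<integral>\<^sup>+e. indicator {e. e - (s / (1 + \<rho>)) *\<^sub>R (S *v c) \<in> B} e * ennreal (exp (s / (1 + \<rho>) * (e $ i + e $ j))) \<partial>mvnormal S)"
    if [measurable]: "B \<in> sets borel" for B s
  proof -
    \<comment> \<open>Coordinates \<open>i\<close> and \<open>j\<close> of \<open>S *v c\<close>
      equal \<open>1 + \<rho>\<close>, so this shift moves the corner of the orthant at
      \<open>- s\<close> to the origin.\<close>
    let ?l = "(- (s / (1 + \<rho>))) *\<^sub>R c"
    have l: "S *v ?l = - ((s / (1 + \<rho>)) *\<^sub>R (S *v c))"
      by (subst matrix_vector_mult_scaleR) simp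
    have q: "?l \<bullet> (S *v ?l) / 2 = s\<^sup>2 / (1 + \<rho>)"
    proof -
      have "?l \<bullet> (S *v ?l) = (s / (1 + \<rho>))\<^sup>2 * (c \<bullet> (S *v c))"
        unfolding l by (simp add: power2_eq_square)
      moreover have "(s / k)\<^sup>2 * (2 * k) / 2 = s\<^sup>2 / k" if "0 < k" for k
        using that by (simp add: power2_eq_square field_simps)
      ultimately show ?thesis using \<rho> unfolding cc by (simp only: real_0_less_add_iff)
    qed
    have "emeasure (mvnormal S) B = (\<integral>\<^sup>+e. indicator B e \<partial>mvnormal S)" by simp
    also have "\<dots> = (\<integral>\<^sup>+e. indicator B (e + S *v ?l) * ennreal (exp (- (?l \<bullet> e) - (?l \<bullet> (S *v ?l)) / 2)) \<partial>mvnormal S)"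
      by (rule cameron_martin_mvnormal[OF S]) measurable
    also have "\<dots> = (\<integral>\<^sup>+e. ennreal (exp (- s\<^sup>2 / (1 + \<rho>))) * (indicator {e. e - (s / (1 + \<rho>)) *\<^sub>R (S *v c) \<in> B} e * ennreal (exp (s / (1 + \<rho>) * (e $ i + e $ j)))) \<partial>mvnormal S)"
    proof (rule nn_integral_cong)
      fix e
      have "ennreal (exp (- (?l \<bullet> e) - (?l \<bullet> (S *v ?l)) / 2))
          = ennreal (exp (- s\<^sup>2 / (1 + \<rho>))) * ennreal (exp (s / (1 + \<rho>) * (e $ i + e $ j)))"
        unfolding q by (simp add: ce ennreal_mult[symmetric] exp_add[symmetric])
      then show "indicator B (e + S *v ?l) * ennreal (exp (- (?l \<bullet> e) - (?l \<bullet> (S *v ?l)) / 2))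
        = ennreal (exp (- s\<^sup>2 / (1 + \<rho>))) * (indicator {e. e - (s / (1 + \<rho>)) *\<^sub>R (S *v c) \<in> B} e * ennreal (exp (s / (1 + \<rho>) * (e $ i + e $ j))))"
        unfolding l by (simp add: indicator_def)
    qed
    also have "\<dots> = ennreal (exp (- s\<^sup>2 / (1 + \<rho>))) *
      (\<integral>\<^sup>+e. indicator {e. e - (s / (1 + \<rho>)) *\<^sub>R (S *v c) \<in> B} e * ennreal (exp (s / (1 + \<rho>) * (e $ i + e $ j))) \<partial>mvnormal S)"
      by (rule nn_integral_cmult) measurable
    finally show ?thesis .
  qed
  have coord: "(e - (s / (1 + \<rho>)) *\<^sub>R (S *v c)) $ i = e $ i - s" "(e - (s / (1 + \<rho>)) *\<^sub>R (S *v c)) $ j = e $ j - s" for e s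
  proof -
    have "(S *v c) $ i = 1 + \<rho>" "(S *v c) $ j = 1 + \<rho>"
      using Sc[of i] Sc[of j] tr[of i j] diag by (simp_all add: \<rho>_def)
    then show "(e - (s / (1 + \<rho>)) *\<^sub>R (S *v c)) $ i = e $ i - s"
      "(e - (s / (1 + \<rho>)) *\<^sub>R (S *v c)) $ j = e $ j - s"
      using \<rho> by simp_all
  qed
  \<comment> \<open>A fixed open piece of the shifted orthant on which the exponential weight is at
    least \<open>exp (- (2 * s / (1 + \<rho>)))\<close>; this loss is only linear in
    \<open>s\<close>.\<close>
  let ?U = "{e::real^'i. - 1 < e $ i \<and> e $ i < 0 \<and> - 1 < e $ j \<and> e $ j < 0}"
  have openU: "open ?U"
    by (intro open_Collect_conj open_Collect_less continuous_intros)
  have [measurable]: "?U \<in> sets borel" using openU by (rule borel_open)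
  show "\<exists>k>0. \<forall>s\<ge>0. k * exp (- s\<^sup>2 / (1 + \<rho>) - 2 * s / (1 + \<rho>)) \<le> measure (mvnormal S) {e. e $ i < - s \<and> e $ j < - s}"
  proof (intro exI[of _ "measure (mvnormal S) ?U"] conjI allI impI)
    have "(\<chi> k. - 1 / 2) \<in> ?U" by simp
    then have "0 < emeasure (mvnormal S) ?U" using emeasure_mvnormal_open_pos[OF S openU] by blast
    then show "0 < measure (mvnormal S) ?U" by (simp add: emeasure_eq_measure)
    fix s :: real assume s: "0 \<le> s"
    have "ennreal (exp (- (2 * s / (1 + \<rho>)))) * emeasure (mvnormal S) ?U
        = (\<integral>\<^sup>+e. ennreal (exp (- (2 * s / (1 + \<rho>)))) * indicator ?U e \<partial>mvnormal S)"
      by (subst nn_integral_cmult_indicator) auto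
    also have "\<dots> \<le> (\<integral>\<^sup>+e. indicator {e. e - (s / (1 + \<rho>)) *\<^sub>R (S *v c) \<in> {e. e $ i < - s \<and> e $ j < - s}} e * ennreal (exp (s / (1 + \<rho>) * (e $ i + e $ j))) \<partial>mvnormal S)"
    proof (rule nn_integral_mono)
      fix e
      have "- (2 * s / (1 + \<rho>)) \<le> s / (1 + \<rho>) * (e $ i + e $ j)" if "e \<in> ?U"
      proof -
        have "s / (1 + \<rho>) * (- 2) \<le> s / (1 + \<rho>) * (e $ i + e $ j)"
          using that s \<rho> by (intro mult_left_mono) auto
        then show ?thesis by (simp add: mult.commute)
      qed
      then show "ennreal (exp (- (2 * s / (1 + \<rho>)))) * indicator ?U e \<le>
        indicator {e. e - (s / (1 + \<rho>)) *\<^sub>R (S *v c) \<in> {e. e $ i < - s \<and> e $ j < - s}} e * ennreal (exp (s / (1 + \<rho>) * (e $ i + e $ j)))"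
        using coord[of e s] by (auto simp: indicator_def)
    qed
    finally have "ennreal (exp (- s\<^sup>2 / (1 + \<rho>))) * (ennreal (exp (- (2 * s / (1 + \<rho>)))) * emeasure (mvnormal S) ?U)
      \<le> emeasure (mvnormal S) {e. e $ i < - s \<and> e $ j < - s}"
      by (subst shift[of _ s]) (auto intro!: mult_left_mono)
    then have "exp (- s\<^sup>2 / (1 + \<rho>)) * (exp (- (2 * s / (1 + \<rho>))) * measure (mvnormal S) ?U)
      \<le> measure (mvnormal S) {e. e $ i < - s \<and> e $ j < - s}"
      by (simp add: emeasure_eq_measure ennreal_mult[symmetric])
    then show "measure (mvnormal S) ?U * exp (- s\<^sup>2 / (1 + \<rho>) - 2 * s / (1 + \<rho>)) \<le> measure (mvnormal S) {e. e $ i < - s \<and> e $ j < - s}"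
      by (simp add: exp_diff exp_minus divide_inverse mult_ac)
  qed
  \<comment> \<open>After the shift both coordinates are at most 0, where the weight is at most 1,
    so the total mass serves as the constant.\<close>
  show "\<exists>k>0. \<forall>s\<ge>0. measure (mvnormal S) {e. e $ i \<le> - s \<and> e $ j \<le> - s} \<le> k * exp (- s\<^sup>2 / (1 + \<rho>))"
  proof (intro exI[of _ "measure (mvnormal S) UNIV"] conjI allI impI)
    have "0 < emeasure (mvnormal S) UNIV" using emeasure_mvnormal_open_pos[OF S open_UNIV] by blast
    then show "0 < measure (mvnormal S) UNIV" by (simp add: emeasure_eq_measure)
    fix s :: real assume s: "0 \<le> s"
    have "(\<integral>\<^sup>+e. indicator {e. e - (s / (1 + \<rho>)) *\<^sub>R (S *v c) \<in> {e. e $ i \<le> - s \<and> e $ j \<le> - s}} e * ennreal (exp (s / (1 + \<rho>) * (e $ i + e $ j))) \<partial>mvnormal S)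
       \<le> (\<integral>\<^sup>+e. 1 \<partial>mvnormal S)"
    proof (rule nn_integral_mono)
      fix e
      have "s / (1 + \<rho>) * (e $ i + e $ j) \<le> 0" if "e $ i \<le> 0" "e $ j \<le> 0"
        using that s \<rho> by (intro mult_nonneg_nonpos) auto
      then show "indicator {e. e - (s / (1 + \<rho>)) *\<^sub>R (S *v c) \<in> {e. e $ i \<le> - s \<and> e $ j \<le> - s}} e * ennreal (exp (s / (1 + \<rho>) * (e $ i + e $ j))) \<le> 1"
        using coord[of e s] by (auto simp: indicator_def)
    qed
    then have "emeasure (mvnormal S) {e. e $ i \<le> - s \<and> e $ j \<le> - s} \<le> ennreal (exp (- s\<^sup>2 / (1 + \<rho>))) * emeasure (mvnormal S) UNIV"
      by (subst shift[of _ s]) (auto intro!: mult_left_mono)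
    then show "measure (mvnormal S) {e. e $ i \<le> - s \<and> e $ j \<le> - s} \<le> measure (mvnormal S) UNIV * exp (- s\<^sup>2 / (1 + \<rho>))"
      by (simp add: emeasure_eq_measure ennreal_mult[symmetric] mult.commute)
  qed
qed

section \<open>Convolution of bounded functions with the normal law\<close>

context
  fixes S :: "real^'i::finite^'i"
  assumes S: "pos_def S"
begin

lemma integrable_mvnormal_bounded:
  assumes [measurable]: "g \<in> borel_measurable borel" and bounded: "AE v in lborel. \<bar>g v\<bar> \<le> 1"
  shows "integrable (mvnormal S) (\<lambda>e. g (u - e) :: real)"
proof -
  interpret finite_measure "mvnormal S" by (rule finite_measure_mvnormal[OF S])
  have "AE e in lborel. \<bar>g (u - e)\<bar> \<le> 1"
    by (subst AE_lborel_reflect_iff) (rule bounded)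
  then have "AE e in mvnormal S. norm (g (u - e)) \<le> 1"
    by (simp add: AE_mvnormal_iff[OF S])
  then show ?thesis by (rule integrable_const_bound) measurable
qed

text \<open>Expanding the quadratic form separates \<open>u\<close> from \<open>v\<close>: a
  convolution is an explicit positive factor times a Laplace transform at
  \<open>matrix_inv S *v u\<close>. Continuity and injectivity both rest on this form.\<close>

lemma integral_mvnormal_reflect:
  fixes g :: "real^'i \<Rightarrow> real"
  assumes [measurable]: "g \<in> borel_measurable borel"
  shows "(\<integral>e. g (u - e) \<partial>mvnormal S)
    = gauss_const S * exp (- (u \<bullet> (matrix_inv S *v u)) / 2)
      * (\<integral>v. (g v * exp (- (v \<bullet> (matrix_inv S *v v)) / 2)) * exp ((matrix_inv S *v u) \<bullet> v) \<partial>lborel)"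
proof -
  obtain \<kappa> where "gauss_form ((*v) (matrix_inv S)) \<kappa>" using pos_def_gauss_form[OF S] .
  then interpret gauss_form "(*v) (matrix_inv S)" \<kappa> .
  have "(\<integral>e. g (u - e) \<partial>mvnormal S) = (\<integral>e. gauss_density S e * g (u - e) \<partial>lborel)"
    unfolding mvnormal_def
    by (subst integral_density) (auto simp: less_imp_le[OF gauss_density_pos[OF S]])
  also have "\<dots> = (\<integral>e. (\<lambda>v. gauss_density S (u - v) * g v) (u - e) \<partial>lborel)"
    by simp
  also have "\<dots> = (\<integral>v. gauss_density S (u - v) * g v \<partial>lborel)"
    by (rule lborel_integral_reflect) measurable
  also have "\<dots> = (\<integral>v. (gauss_const S * exp (- (u \<bullet> (matrix_inv S *v u)) / 2))
      * ((g v * exp (- (v \<bullet> (matrix_inv S *v v)) / 2)) * exp ((matrix_inv S *v u) \<bullet> v)) \<partial>lborel)"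
  proof (intro Bochner_Integration.integral_cong refl)
    fix v
    have "gauss_density S (u - v) = gauss_const S * exp (- (Q u - 2 * ((matrix_inv S *v v) \<bullet> u) + Q v) / 2)"
      unfolding gauss_density_eq Q_diff[symmetric] by (simp add: Q_def)
    also have "(matrix_inv S *v v) \<bullet> u = (matrix_inv S *v u) \<bullet> v"
      using sym[of v u] by (simp add: inner_commute)
    finally show "gauss_density S (u - v) * g v = (gauss_const S * exp (- (u \<bullet> (matrix_inv S *v u)) / 2))
      * ((g v * exp (- (v \<bullet> (matrix_inv S *v v)) / 2)) * exp ((matrix_inv S *v u) \<bullet> v))"
    proof -
      have "- (a - 2 * x + b) / 2 = - a / 2 + (- b / 2 + x)" for a b x :: real by simp
      then have E: "exp (- (a - 2 * x + b) / 2) = exp (- a / 2) * (exp (- b / 2) * exp x)" for a b x :: real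
        by (simp only: exp_add)
      then show ?thesis if "gauss_density S (u - v)
          = gauss_const S * exp (- (Q u - 2 * ((matrix_inv S *v u) \<bullet> v) + Q v) / 2)"
        unfolding that Q_def E by (simp only: mult_ac)
    qed
  qed
  finally show ?thesis by simp
qed

lemma integrable_exp_moments:
  fixes g :: "real^'i \<Rightarrow> real"
  assumes [measurable]: "g \<in> borel_measurable borel" and bounded: "AE v in lborel. \<bar>g v\<bar> \<le> 1"
  shows "(\<lambda>v. g v * exp (- (v \<bullet> (matrix_inv S *v v)) / 2)) \<in> borel_measurable borel"
    and "integrable lborel (\<lambda>v. g v * exp (- (v \<bullet> (matrix_inv S *v v)) / 2) * exp (R * norm v))"
proof -
  obtain \<kappa> where "gauss_form ((*v) (matrix_inv S)) \<kappa>" using pos_def_gauss_form[OF S] .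
  then interpret gauss_form "(*v) (matrix_inv S)" \<kappa> .
  have [measurable]: "(\<lambda>v. v \<bullet> (matrix_inv S *v v)) \<in> borel_measurable borel"
    using measurable_Q by (simp add: Q_def[abs_def])
  show "(\<lambda>v. g v * exp (- (v \<bullet> (matrix_inv S *v v)) / 2)) \<in> borel_measurable borel"
    by measurable
  have "integrable lborel (\<lambda>v. exp (- (v \<bullet> (matrix_inv S *v v)) / 2) * exp (R * norm v))"
    using integrable_exp_Q[of "1/2" R] by (simp add: Q_def)
  then show "integrable lborel (\<lambda>v. g v * exp (- (v \<bullet> (matrix_inv S *v v)) / 2) * exp (R * norm v))"
  proof (rule Bochner_Integration.integrable_bound)
    show "AE v in lborel. norm (g v * exp (- (v \<bullet> (matrix_inv S *v v)) / 2) * exp (R * norm v))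
      \<le> norm (exp (- (v \<bullet> (matrix_inv S *v v)) / 2) * exp (R * norm v))"
      using bounded by eventually_elim (auto simp: abs_mult mult_left_le_one_le)
  qed measurable
qed

lemma continuous_integral_mvnormal_reflect:
  fixes g :: "real^'i \<Rightarrow> real"
  assumes g: "g \<in> borel_measurable borel" and bounded: "AE v in lborel. \<bar>g v\<bar> \<le> 1"
  shows "continuous_on UNIV (\<lambda>u. \<integral>e. g (u - e) \<partial>mvnormal S)"
proof -
  have lin: "continuous_on UNIV (\<lambda>u. matrix_inv S *v u)"
    by (simp add: linear_continuous_on linear_conv_bounded_linear[symmetric])
  show ?thesis
    unfolding integral_mvnormal_reflect[OF g]
    by (intro continuous_intros lin
        continuous_on_compose2[OF continuous_laplace[OF integrable_exp_moments[OF g bounded]] lin]) auto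
qed

lemma mvnormal_deconvolution:
  fixes g g' :: "real^'i \<Rightarrow> real"
  assumes g[measurable]: "g \<in> borel_measurable borel" "g' \<in> borel_measurable borel"
    and bounded: "AE v in lborel. 0 \<le> g v \<and> g v \<le> 1" "AE v in lborel. 0 \<le> g' v \<and> g' v \<le> 1"
    and eq: "\<And>u. (\<integral>e. g (u - e) \<partial>mvnormal S) = (\<integral>e. g' (u - e) \<partial>mvnormal S)"
  shows "AE v in lborel. g v = g' v"
proof -
  obtain \<kappa> where "gauss_form ((*v) (matrix_inv S)) \<kappa>" using pos_def_gauss_form[OF S] .
  then interpret gauss_form "(*v) (matrix_inv S)" \<kappa> .
  let ?d = "\<lambda>v. g v - g' v"
  have b: "AE v in lborel. \<bar>g v\<bar> \<le> 1" "AE v in lborel. \<bar>g' v\<bar> \<le> 1"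
    using bounded by (eventually_elim, simp)+
  have d: "?d \<in> borel_measurable borel" "AE v in lborel. \<bar>?d v\<bar> \<le> 1"
  proof -
    show "AE v in lborel. \<bar>?d v\<bar> \<le> 1" using bounded by eventually_elim auto
  qed measurable
  have "null_laplace (\<lambda>v. ?d v * exp (- (v \<bullet> (matrix_inv S *v v)) / 2))"
    unfolding null_laplace_def
  proof (intro conjI allI)
    fix l
    \<comment> \<open>The point \<open>u = S *v l\<close> is chosen so that the transform is
      evaluated at \<open>l\<close>.\<close>
    have "0 = (\<integral>e. g (S *v l - e) \<partial>mvnormal S) - (\<integral>e. g' (S *v l - e) \<partial>mvnormal S)"
      by (simp add: eq)
    also have "\<dots> = (\<integral>e. ?d (S *v l - e) \<partial>mvnormal S)"
      by (rule Bochner_Integration.integral_diff[symmetric])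
        (auto intro!: integrable_mvnormal_bounded b)
    finally show "(\<integral>v. ?d v * exp (- (v \<bullet> (matrix_inv S *v v)) / 2) * exp (l \<bullet> v) \<partial>lborel) = 0"
      unfolding integral_mvnormal_reflect[OF d(1)] pos_def_inverse[OF S]
      using gauss_const_pos[OF S] by simp
  qed (use integrable_exp_moments[OF d] in auto)
  then have "null_laplace (\<lambda>v. ?d v * exp (- (1/2) * Q v))"
    by (simp add: Q_def)
  then have "AE v in lborel. ?d v = 0"
    by (rule null_laplace_imp_AE_zero[OF d]) simp
  then show ?thesis by simp
qed

text \<open>Each player has a dominant action once \<open>\<bar>v\<^sub>i\<bar> > M\<close>, so that the probability of joint entry
  by \<open>i\<close> and \<open>j\<close> lies between two orthant probabilities.\<close>

lemma integral_mvnormal_sandwich: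
  fixes p :: "real^'i \<Rightarrow> real"
  assumes p[measurable]: "p \<in> borel_measurable borel" and bounded: "AE v in lborel. 0 \<le> p v \<and> p v \<le> 1"
    and one: "AE v in lborel. v $ i > M \<and> v $ j > M \<longrightarrow> p v = 1"
    and zero: "AE v in lborel. v $ i < - M \<or> v $ j < - M \<longrightarrow> p v = 0"
  shows "measure (mvnormal S) {e. e $ i < u $ i - M \<and> e $ j < u $ j - M} \<le> (\<integral>e. p (u - e) \<partial>mvnormal S)"
    and "(\<integral>e. p (u - e) \<partial>mvnormal S) \<le> measure (mvnormal S) {e. e $ i \<le> u $ i + M \<and> e $ j \<le> u $ j + M}"
proof -
  interpret finite_measure "mvnormal S" by (rule finite_measure_mvnormal[OF S])
  have int: "integrable (mvnormal S) (\<lambda>e. p (u - e))"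
  proof (rule integrable_mvnormal_bounded[OF p])
    show "AE v in lborel. \<bar>p v\<bar> \<le> 1" using bounded by eventually_elim auto
  qed
  have AE: "AE e in mvnormal S. P (u - e)" if "AE v in lborel. P v" for P
    by (simp add: AE_mvnormal_iff[OF S] AE_lborel_reflect_iff that)
  note ae = AE[OF bounded] AE[OF one] AE[OF zero]
  have "measure (mvnormal S) {e. e $ i < u $ i - M \<and> e $ j < u $ j - M}
      = (\<integral>e. indicator {e. e $ i < u $ i - M \<and> e $ j < u $ j - M} e \<partial>mvnormal S)" by simp
  also have "\<dots> \<le> (\<integral>e. p (u - e) \<partial>mvnormal S)"
  proof (rule integral_mono_AE)
    show "AE e in mvnormal S. indicator {e. e $ i < u $ i - M \<and> e $ j < u $ j - M} e \<le> p (u - e)"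
      using ae by eventually_elim (auto simp: indicator_def)
  qed (auto simp: int integrable_indicator_iff emeasure_eq_measure)
  finally show "measure (mvnormal S) {e. e $ i < u $ i - M \<and> e $ j < u $ j - M} \<le> (\<integral>e. p (u - e) \<partial>mvnormal S)" .
  have "(\<integral>e. p (u - e) \<partial>mvnormal S)
      \<le> (\<integral>e. indicator {e. e $ i \<le> u $ i + M \<and> e $ j \<le> u $ j + M} e \<partial>mvnormal S)"
  proof (rule integral_mono_AE)
    show "AE e in mvnormal S. p (u - e) \<le> indicator {e. e $ i \<le> u $ i + M \<and> e $ j \<le> u $ j + M} e"
      using ae by eventually_elim (auto simp: indicator_def)
  qed (auto simp: int integrable_indicator_iff emeasure_eq_measure)
  then show "(\<integral>e. p (u - e) \<partial>mvnormal S) \<le> measure (mvnormal S) {e. e $ i \<le> u $ i + M \<and> e $ j \<le> u $ j + M}"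
    by simp
qed

end

text \<open>After taking logarithms both sides are quadratic in \<open>t\<close>, and only the
  leading coefficients matter for large \<open>t\<close>; the shifts \<open>M\<close>,
  \<open>M'\<close> and the constants \<open>k\<close>, \<open>k'\<close> affect lower orders
  only.\<close>

lemma tail_rate_compare:
  fixes a b r M M' k k' :: real
  assumes pos: "0 < a" "0 < b" "0 < k" "0 < k'" "0 \<le> r" "0 \<le> M'"
    and le: "\<And>t. M \<le> t \<Longrightarrow> k * exp (- (r * t + M')\<^sup>2 / b - 2 * (r * t + M') / b) \<le> k' * exp (- (t - M)\<^sup>2 / a)"
  shows "1 / a \<le> r\<^sup>2 / b"
proof (rule ccontr)
  assume neg: "\<not> ?thesis"
  \<comment> \<open>\<open>A\<close>, \<open>B\<close>, \<open>C\<close> are the coefficients of the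
    difference of the two exponents as a polynomial in \<open>t\<close>.\<close>
  define A where "A = 1 / a - r\<^sup>2 / b"
  define B where "B = - 2 * M / a - (2 * r * M' + 2 * r) / b"
  define C where "C = M\<^sup>2 / a - (M'\<^sup>2 + 2 * M') / b"
  have "0 < A" using neg by (simp add: A_def)
  then have "filterlim (\<lambda>t. A * t\<^sup>2 + B * t + C) at_top at_top" by real_asymp
  then have "eventually (\<lambda>t. ln (k' / k) < A * t\<^sup>2 + B * t + C) at_top"
    by (simp add: filterlim_at_top_dense)
  then have "eventually (\<lambda>t. ln (k' / k) < A * t\<^sup>2 + B * t + C \<and> M \<le> t) at_top"
    using eventually_ge_at_top by (rule eventually_conj)
  then obtain t where t: "ln (k' / k) < A * t\<^sup>2 + B * t + C" "M \<le> t"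
    using eventually_happens'[OF trivial_limit_at_top_linorder] by blast
  have "ln (k * exp (- (r * t + M')\<^sup>2 / b - 2 * (r * t + M') / b)) \<le> ln (k' * exp (- (t - M)\<^sup>2 / a))"
    using le[OF t(2)] pos by simp
  then have "- (r * t + M')\<^sup>2 / b - 2 * (r * t + M') / b + (t - M)\<^sup>2 / a \<le> ln (k' / k)"
    using pos by (simp add: ln_mult ln_div)
  also have "- (r * t + M')\<^sup>2 / b - 2 * (r * t + M') / b + (t - M)\<^sup>2 / a = A * t\<^sup>2 + B * t + C"
    using pos by (simp add: A_def B_def C_def power2_eq_square field_simps)
  finally show False using t(1) by simp
qed

section \<open>Rationalizable play and identification\<close>

text \<open>What two rounds of elimination force at index \<open>v\<close>: a dominant action is
  played, and a player whose opponents all have dominant actions \<open>s\<close> best-replies to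
  \<open>s\<close>. Ties impose nothing.\<close>

definition dominance_consistent :: "('i::finite \<Rightarrow> ('i \<Rightarrow> bool) \<Rightarrow> real) \<Rightarrow> real^'i \<Rightarrow> ('i \<Rightarrow> bool) \<Rightarrow> bool" where
  "dominance_consistent al v y \<longleftrightarrow>
     (\<forall>i. ((\<forall>t. 0 < al i t + v $ i) \<longrightarrow> y i) \<and> ((\<forall>t. al i t + v $ i < 0) \<longrightarrow> \<not> y i))
   \<and> (\<forall>i s. (\<forall>j. j \<noteq> i \<longrightarrow> (if s j then \<forall>t. 0 < al j t + v $ j else \<forall>t. al j t + v $ j < 0)) \<longrightarrow>
        (0 < al i s + v $ i \<longrightarrow> y i) \<and> (al i s + v $ i < 0 \<longrightarrow> \<not> y i))"

lemma dominance_consistent_best_reply: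
  assumes "dominance_consistent al v y"
    and "\<And>j. j \<noteq> i \<Longrightarrow> (if s j then \<forall>t. 0 < al j t + v $ j else \<forall>t. al j t + v $ j < 0)"
  shows "(0 < al i s + v $ i \<longrightarrow> y i) \<and> (al i s + v $ i < 0 \<longrightarrow> \<not> y i)"
  using assms unfolding dominance_consistent_def by blast

lemma rationalizable_dominance_consistent:
  fixes \<theta> :: "('i::finite,'dw::finite) param"
  assumes \<theta>: "\<theta> \<in> Theta" and y: "y \<in> rationalizable \<theta> x e"
  shows "dominance_consistent (\<lambda>i t. alpha \<theta> i t (snd x)) (\<chi> i. beta \<theta> i (snd x) * (fst x $ i) - e $ i) y"
proof -
  define al where "al i t = alpha \<theta> i t (snd x)" for i t
  define v where "v i = beta \<theta> i (snd x) * (fst x $ i) - e $ i" for i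
  \<comment> \<open>Membership in \<open>Theta\<close> removes the dependence on the own action, so
    that updating a profile at \<open>i\<close> does not change \<open>al i\<close>.\<close>
  have own: "al i t = al i t'" if "\<And>j. j \<noteq> i \<Longrightarrow> t j = t' j" for i t t'
    using \<theta> that unfolding Theta_def al_def by blast
  have pay: "payoff \<theta> x e i (t(i := True)) = al i t + v i" "payoff \<theta> x e i (t(i := False)) = 0" for i t
    using own[of i "t(i := True)" t] by (auto simp: payoff_def al_def v_def)
  have yk: "y i \<in> surv \<theta> x e k i" for i k using y by (simp add: rationalizable_def)
  have surv1: "False \<notin> surv \<theta> x e 1 i" if "\<And>t. 0 < al i t + v i" for i
    using that by (auto simp: pay intro!: exI[of _ 1])
  have surv2: "True \<notin> surv \<theta> x e 1 i" if "\<And>t. al i t + v i < 0" for i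
    using that by (auto simp: pay intro!: exI[of _ 0])
  have first: "(\<forall>t. 0 < al i t + v i) \<longrightarrow> y i" "(\<forall>t. al i t + v i < 0) \<longrightarrow> \<not> y i" for i
    using surv1[of i] surv2[of i] yk[of i 1] by (metis (full_types))+
  have second: "(0 < al i s + v i \<longrightarrow> y i) \<and> (al i s + v i < 0 \<longrightarrow> \<not> y i)"
    if s: "\<And>j. j \<noteq> i \<Longrightarrow> (if s j then \<forall>t. 0 < al j t + v j else \<forall>t. al j t + v j < 0)" for i s
  proof -
    \<comment> \<open>Opponents with a dominant action keep only that action after the first round,
      so the second round is a comparison at \<open>s\<close> alone.\<close>
    have others: "t j = s j" if "t j \<in> surv \<theta> x e 1 j" "j \<noteq> i" for t j
      using s[OF that(2)] surv1[of j] surv2[of j] that(1) by (cases "s j"; cases "t j") (simp_all del: One_nat_def surv.simps)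
    have ali: "al i t = al i s" if "\<forall>j. j \<noteq> i \<longrightarrow> t j \<in> surv \<theta> x e 1 j" for t
      using others that by (intro own) blast
    have "False \<notin> surv \<theta> x e (Suc 1) i" if pos: "0 < al i s + v i"
    proof -
      \<comment> \<open>A dominating mixture may only use surviving actions, so \<open>True\<close>
        must be shown to survive the first round: at \<open>s\<close> no mixture exceeds its
        positive payoff.\<close>
      have "\<not> q * (al i s + v i) + (1 - q) * 0 > al i s + v i" if "q \<le> 1" for q
        using mult_right_mono[OF that less_imp_le[OF pos]] by simp
      then have "True \<in> surv \<theta> x e 1 i" using pay by (fastforce simp: pay)
      moreover have "\<forall>t. (\<forall>j. j \<noteq> i \<longrightarrow> t j \<in> surv \<theta> x e 1 j) \<longrightarrow>
          1 * payoff \<theta> x e i (t(i := True)) + (1 - 1) * payoff \<theta> x e i (t(i := False))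
          > payoff \<theta> x e i (t(i := False))"
        using pos ali by (simp only: pay) simp
      ultimately have "\<exists>q::real. 0 \<le> q \<and> q \<le> 1
          \<and> (0 < q \<longrightarrow> True \<in> surv \<theta> x e 1 i) \<and> (q < 1 \<longrightarrow> False \<in> surv \<theta> x e 1 i)
          \<and> (\<forall>t. (\<forall>j. j \<noteq> i \<longrightarrow> t j \<in> surv \<theta> x e 1 j) \<longrightarrow>
            q * payoff \<theta> x e i (t(i := True)) + (1 - q) * payoff \<theta> x e i (t(i := False))
            > payoff \<theta> x e i (t(i := False)))"
        by (intro exI[of _ 1]) (simp del: One_nat_def surv.simps fun_upd_apply)
      then show ?thesis unfolding surv.simps(2)[of \<theta> x e 1] by blast
    qed
    moreover have "True \<notin> surv \<theta> x e (Suc 1) i" if neg: "al i s + v i < 0"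
    proof -
      have "\<not> q * (al i s + v i) + (1 - q) * 0 > 0" if "0 \<le> q" for q
        using mult_nonneg_nonpos[OF that less_imp_le[OF neg]] by simp
      then have "False \<in> surv \<theta> x e 1 i" using pay by (fastforce simp: pay)
      moreover have "\<forall>t. (\<forall>j. j \<noteq> i \<longrightarrow> t j \<in> surv \<theta> x e 1 j) \<longrightarrow>
          0 * payoff \<theta> x e i (t(i := True)) + (1 - 0) * payoff \<theta> x e i (t(i := False))
          > payoff \<theta> x e i (t(i := True))"
        using neg ali by (simp only: pay) simp
      ultimately have "\<exists>q::real. 0 \<le> q \<and> q \<le> 1
          \<and> (0 < q \<longrightarrow> True \<in> surv \<theta> x e 1 i) \<and> (q < 1 \<longrightarrow> False \<in> surv \<theta> x e 1 i)
          \<and> (\<forall>t. (\<forall>j. j \<noteq> i \<longrightarrow> t j \<in> surv \<theta> x e 1 j) \<longrightarrow>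
            q * payoff \<theta> x e i (t(i := True)) + (1 - q) * payoff \<theta> x e i (t(i := False))
            > payoff \<theta> x e i (t(i := True)))"
        by (intro exI[of _ 0]) (simp del: One_nat_def surv.simps fun_upd_apply)
      then show ?thesis unfolding surv.simps(2)[of \<theta> x e 1] by blast
    qed
    ultimately show ?thesis using yk[of i "Suc 1"] by (metis (full_types))
  qed
  show ?thesis
    unfolding dominance_consistent_def al_def[symmetric] vec_lambda_beta v_def[symmetric]
    using first second by blast
qed

section \<open>Identification at a fixed value of \<open>w\<close>\<close>

text \<open>Play at one \<open>w\<close> as a function of the index alone. Its properties are
  required only almost everywhere, since the index form represents \<open>h\<close> only up to null
  sets.\<close>

definition consistent_play :: "('i::finite \<Rightarrow> ('i \<Rightarrow> bool) \<Rightarrow> real) \<Rightarrow> (('i \<Rightarrow> bool) \<Rightarrow> real^'i \<Rightarrow> real) \<Rightarrow> bool" where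
  "consistent_play al g \<longleftrightarrow> (\<forall>y. g y \<in> borel_measurable borel) \<and>
     (AE v in lborel. (\<forall>y. 0 \<le> g y v) \<and> (\<Sum>y\<in>UNIV. g y v) = 1
        \<and> (\<forall>y. 0 < g y v \<longrightarrow> dominance_consistent al v y))"

lemma bounded_interaction:
  fixes al :: "'i::finite \<Rightarrow> ('i \<Rightarrow> bool) \<Rightarrow> real"
  obtains M where "0 \<le> M" "\<And>i t. \<bar>al i t\<bar> \<le> M"
proof
  let ?M = "\<Sum>(i, t)\<in>UNIV. \<bar>al i t\<bar>"
  show "0 \<le> ?M" by (intro sum_nonneg) auto
  show "\<bar>al i t\<bar> \<le> ?M" for i t
    using member_le_sum[of "(i, t)" UNIV "\<lambda>(i, t). \<bar>al i t\<bar>"] by auto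
qed

lemma consistent_play_measurable:
  "consistent_play al g \<Longrightarrow> g y \<in> borel_measurable borel"
  by (simp add: consistent_play_def)

lemma consistent_play_bounded:
  assumes "consistent_play al g" shows "AE v in lborel. 0 \<le> g y v \<and> g y v \<le> 1"
proof -
  have "AE v in lborel. (\<forall>y. 0 \<le> g y v) \<and> (\<Sum>y\<in>UNIV. g y v) = 1
        \<and> (\<forall>y. 0 < g y v \<longrightarrow> dominance_consistent al v y)"
    using assms by (simp only: consistent_play_def)
  then show ?thesis
  proof (rule eventually_mono)
    fix v assume v: "(\<forall>y. 0 \<le> g y v) \<and> (\<Sum>y\<in>UNIV. g y v) = 1 \<and> (\<forall>y. 0 < g y v \<longrightarrow> dominance_consistent al v y)"
    then show "0 \<le> g y v \<and> g y v \<le> 1" using member_le_sum[of y UNIV "\<lambda>y. g y v"] by auto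
  qed
qed

text \<open>Beyond \<open>M\<close> an action is dominant for every opponent profile. The case
  \<open>i = j\<close> is included on purpose: it describes the entry of a single player, from which
  \<beta> is read.\<close>

lemma joint_entry_bounds:
  fixes g :: "('i::finite \<Rightarrow> bool) \<Rightarrow> real^'i \<Rightarrow> real" and i j :: 'i
  assumes g: "consistent_play al g" and M: "\<And>i t. \<bar>al i t\<bar> \<le> M"
  defines "p \<equiv> \<lambda>v. \<Sum>y\<in>{y. y i \<and> y j}. g y v"
  shows "p \<in> borel_measurable borel" "AE v in lborel. 0 \<le> p v \<and> p v \<le> 1"
    "AE v in lborel. v $ i > M \<and> v $ j > M \<longrightarrow> p v = 1"
    "AE v in lborel. v $ i < - M \<or> v $ j < - M \<longrightarrow> p v = 0"
proof -
  have [measurable]: "\<And>y. g y \<in> borel_measurable borel" using g by (simp add: consistent_play_def)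
  show "p \<in> borel_measurable borel" unfolding p_def by measurable
  have AE: "AE v in lborel. (\<forall>y. 0 \<le> g y v) \<and> (\<Sum>y\<in>UNIV. g y v) = 1
        \<and> (\<forall>y. 0 < g y v \<longrightarrow> dominance_consistent al v y)"
    using g by (simp only: consistent_play_def)
  have hi: "\<forall>t. 0 < al i t + c" if "M < c" for i c using M[of i] that by (smt (verit))
  have lo: "\<forall>t. al i t + c < 0" if "c < - M" for i c using M[of i] that by (smt (verit))
  show "AE v in lborel. 0 \<le> p v \<and> p v \<le> 1"
    using AE
  proof (rule eventually_mono)
    fix v assume v: "(\<forall>y. 0 \<le> g y v) \<and> (\<Sum>y\<in>UNIV. g y v) = 1 \<and> (\<forall>y. 0 < g y v \<longrightarrow> dominance_consistent al v y)"
    then have "p v \<le> (\<Sum>y\<in>UNIV. g y v)" unfolding p_def by (intro sum_mono2) auto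
    then show "0 \<le> p v \<and> p v \<le> 1" using v by (auto simp: p_def intro!: sum_nonneg)
  qed
  show "AE v in lborel. v $ i > M \<and> v $ j > M \<longrightarrow> p v = 1"
    using AE
  proof (rule eventually_mono, intro impI)
    fix v assume v: "(\<forall>y. 0 \<le> g y v) \<and> (\<Sum>y\<in>UNIV. g y v) = 1 \<and> (\<forall>y. 0 < g y v \<longrightarrow> dominance_consistent al v y)"
      and vM: "v $ i > M \<and> v $ j > M"
    have "g y v = 0" if "\<not> (y i \<and> y j)" for y
    proof (rule ccontr)
      assume "g y v \<noteq> 0"
      then have "dominance_consistent al v y" using v by (metis less_eq_real_def)
      then show False using that hi vM unfolding dominance_consistent_def by blast
    qed
    then have "p v = (\<Sum>y\<in>UNIV. g y v)" unfolding p_def by (intro sum.mono_neutral_left) auto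
    then show "p v = 1" using v by simp
  qed
  show "AE v in lborel. v $ i < - M \<or> v $ j < - M \<longrightarrow> p v = 0"
    using AE
  proof (rule eventually_mono, intro impI)
    fix v assume v: "(\<forall>y. 0 \<le> g y v) \<and> (\<Sum>y\<in>UNIV. g y v) = 1 \<and> (\<forall>y. 0 < g y v \<longrightarrow> dominance_consistent al v y)"
      and vM: "v $ i < - M \<or> v $ j < - M"
    have "g y v = 0" if "y i \<and> y j" for y
    proof (rule ccontr)
      assume "g y v \<noteq> 0"
      then have "dominance_consistent al v y" using v by (metis less_eq_real_def)
      then show False using that lo vM unfolding dominance_consistent_def by blast
    qed
    then show "p v = 0" by (simp add: p_def)
  qed
qed

text \<open>The upper orthant bound for the first structure is confronted with the lower bound for
  the second at the same covariates. A common ratio \<open>r\<close> at \<open>i\<close> and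
  \<open>j\<close> keeps both index vectors on the diagonal of these two coordinates, where the tail
  rate is known.\<close>

lemma tail_rate_inequality:
  fixes S S' :: "real^'i::finite^'i" and \<beta> \<beta>' :: "'i \<Rightarrow> real"
  assumes S: "pos_def S" "\<And>k. S $ k $ k = 1" and S': "pos_def S'" "\<And>k. S' $ k $ k = 1"
    and \<beta>: "\<And>k. \<beta> k \<noteq> 0" and g: "consistent_play al g" and g': "consistent_play al' g'"
    and eq: "\<And>y z. (\<integral>e. g y ((\<chi> k. \<beta> k * z $ k) - e) \<partial>mvnormal S) = (\<integral>e. g' y ((\<chi> k. \<beta>' k * z $ k) - e) \<partial>mvnormal S')"
    and r: "\<beta>' i = r * \<beta> i" "\<beta>' j = r * \<beta> j"
  shows "1 / (1 + S $ i $ j) \<le> (max 0 r)\<^sup>2 / (1 + S' $ i $ j)"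
proof -
  obtain M where M: "0 \<le> M" "\<And>i t. \<bar>al i t\<bar> \<le> M" using bounded_interaction[of al] by blast
  obtain M' where M': "0 \<le> M'" "\<And>i t. \<bar>al' i t\<bar> \<le> M'" using bounded_interaction[of al'] by blast
  define p where "p v = (\<Sum>y\<in>{y. y i \<and> y j}. g y v)" for v
  define p' where "p' v = (\<Sum>y\<in>{y. y i \<and> y j}. g' y v)" for v
  obtain k' where k': "0 < k'" "\<And>s. 0 \<le> s \<Longrightarrow>
      measure (mvnormal S) {e. e $ i \<le> - s \<and> e $ j \<le> - s} \<le> k' * exp (- s\<^sup>2 / (1 + S $ i $ j))"
    using mvnormal_orthant_tail(3)[OF S, of i j] by auto
  obtain k where k: "0 < k" "\<And>s. 0 \<le> s \<Longrightarrow>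
      k * exp (- s\<^sup>2 / (1 + S' $ i $ j) - 2 * s / (1 + S' $ i $ j)) \<le> measure (mvnormal S') {e. e $ i < - s \<and> e $ j < - s}"
    using mvnormal_orthant_tail(2)[OF S', of i j] by auto
  interpret N': finite_measure "mvnormal S'" by (rule finite_measure_mvnormal[OF S'(1)])
  show ?thesis
  proof (rule tail_rate_compare)
    show "0 < 1 + S $ i $ j" "0 < 1 + S' $ i $ j"
      using mvnormal_orthant_tail(1)[OF S, of i j] mvnormal_orthant_tail(1)[OF S', of i j] by auto
    show "0 < k" "0 < k'" "0 \<le> max 0 r" "0 \<le> M'" using k k' M' by auto
    fix t :: real assume t: "M \<le> t"
    \<comment> \<open>Covariates that put every index of the first structure at \<open>- t\<close>;
      those of the second at \<open>i\<close> and \<open>j\<close> are then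
      \<open>- (r * t)\<close>.\<close>
    define z :: "real^'i" where "z = (\<chi> k. - t / \<beta> k)"
    define u :: "real^'i" where "u = (\<chi> k. \<beta> k * z $ k)"
    define u' :: "real^'i" where "u' = (\<chi> k. \<beta>' k * z $ k)"
    have u: "u $ i = - t" "u $ j = - t" "u' $ i = - (r * t)" "u' $ j = - (r * t)"
      using \<beta> r by (simp_all add: u_def u'_def z_def)
    \<comment> \<open>Truncating \<open>r\<close> at 0 keeps the tail level nonnegative. For
      negative \<open>r\<close> the second structure makes entry likely, and rate 0 is still a valid
      lower bound.\<close>
    let ?s = "max 0 r * t + M'"
    have s: "0 \<le> ?s" "r * t \<le> max 0 r * t"
      using t M M' by (auto intro!: mult_right_mono)
    have "k * exp (- ?s\<^sup>2 / (1 + S' $ i $ j) - 2 * ?s / (1 + S' $ i $ j))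
        \<le> measure (mvnormal S') {e. e $ i < - ?s \<and> e $ j < - ?s}" by (rule k(2)[OF s(1)])
    also have "\<dots> \<le> measure (mvnormal S') {e. e $ i < u' $ i - M' \<and> e $ j < u' $ j - M'}"
      using s(2) by (intro N'.finite_measure_mono) (auto simp: u)
    also have "\<dots> \<le> (\<integral>e. p' (u' - e) \<partial>mvnormal S')"
      using joint_entry_bounds[OF g' M'(2), of i j] unfolding p'_def[symmetric]
      by (intro integral_mvnormal_sandwich(1)[OF S'(1)]) (simp_all only: p'_def)
    also have "\<dots> = (\<Sum>y\<in>{y. y i \<and> y j}. (\<integral>e. g' y (u' - e) \<partial>mvnormal S'))"
      unfolding p'_def
    proof (rule Bochner_Integration.integral_sum)
      show "integrable (mvnormal S') (\<lambda>e. g' y (u' - e))" for y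
        using consistent_play_bounded[OF g', of y]
        by (intro integrable_mvnormal_bounded[OF S'(1)] consistent_play_measurable[OF g'])
          (rule eventually_mono, auto)
    qed
    also have "\<dots> = (\<Sum>y\<in>{y. y i \<and> y j}. (\<integral>e. g y (u - e) \<partial>mvnormal S))"
      unfolding u_def u'_def by (simp only: eq)
    also have "\<dots> = (\<integral>e. p (u - e) \<partial>mvnormal S)"
      unfolding p_def
    proof (rule Bochner_Integration.integral_sum[symmetric])
      show "integrable (mvnormal S) (\<lambda>e. g y (u - e))" for y
        using consistent_play_bounded[OF g, of y]
        by (intro integrable_mvnormal_bounded[OF S(1)] consistent_play_measurable[OF g])
          (rule eventually_mono, auto)
    qed
    also have "\<dots> \<le> measure (mvnormal S) {e. e $ i \<le> u $ i + M \<and> e $ j \<le> u $ j + M}"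
      using joint_entry_bounds[OF g M(2), of i j] unfolding p_def[symmetric]
      by (intro integral_mvnormal_sandwich(2)[OF S(1)]) (simp_all only: p_def)
    also have "\<dots> = measure (mvnormal S) {e. e $ i \<le> - (t - M) \<and> e $ j \<le> - (t - M)}"
      by (simp add: u algebra_simps)
    also have "\<dots> \<le> k' * exp (- (t - M)\<^sup>2 / (1 + S $ i $ j))"
      using t by (intro k'(2)) simp
    finally show "k * exp (- ?s\<^sup>2 / (1 + S' $ i $ j) - 2 * ?s / (1 + S' $ i $ j))
      \<le> k' * exp (- (t - M)\<^sup>2 / (1 + S $ i $ j))" .
  qed
qed

lemma coefficients_identified:
  fixes S S' :: "real^'i::finite^'i" and \<beta> \<beta>' :: "'i \<Rightarrow> real"
  assumes S: "pos_def S" "\<And>k. S $ k $ k = 1" and S': "pos_def S'" "\<And>k. S' $ k $ k = 1"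
    and \<beta>: "\<And>k. \<beta> k \<noteq> 0" "\<And>k. \<beta>' k \<noteq> 0"
    and g: "consistent_play al g" and g': "consistent_play al' g'"
    and eq: "\<And>y z. (\<integral>e. g y ((\<chi> k. \<beta> k * z $ k) - e) \<partial>mvnormal S) = (\<integral>e. g' y ((\<chi> k. \<beta>' k * z $ k) - e) \<partial>mvnormal S')"
  shows "\<beta> = \<beta>'" "S = S'"
proof -
  \<comment> \<open>For \<open>i = j\<close> both denominators are 2. The truncation rules out
    negative ratios, so the sign of \<beta> is identified along with its size.\<close>
  have ge1: "1 \<le> r" if "1 / 2 \<le> (max 0 r)\<^sup>2 / 2" for r :: real
  proof -
    have "1\<^sup>2 \<le> (max 0 r)\<^sup>2" using that by simp
    then have "1 \<le> max 0 r" by (rule power2_le_imp_le) simp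
    then show ?thesis by simp
  qed
  show "\<beta> = \<beta>'"
  proof
    fix i
    have "1 \<le> \<beta>' i / \<beta> i"
      using tail_rate_inequality[OF S S' \<beta>(1) g g' eq, of i "\<beta>' i / \<beta> i" i] \<beta> S S' by (intro ge1) simp
    moreover have "1 \<le> \<beta> i / \<beta>' i"
      using tail_rate_inequality[OF S' S \<beta>(2) g' g eq[symmetric], of i "\<beta> i / \<beta>' i" i] \<beta> S S' by (intro ge1) simp
    ultimately have "\<beta>' i / \<beta> i = 1"
      using mult_mono[of 1 "\<beta> i / \<beta>' i" "\<beta>' i / \<beta> i" "\<beta>' i / \<beta> i"] \<beta>[of i] by simp
    then show "\<beta> i = \<beta>' i" using \<beta>[of i] by simp
  qed
  \<comment> \<open>With ratio 1 for all players the tail inequality applies to any pair, and its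
    two directions equate the rates.\<close>
  then have r: "\<beta>' i = 1 * \<beta> i" "\<beta> i = 1 * \<beta>' i" for i by auto
  have "S $ i $ j = S' $ i $ j" for i j
  proof -
    have pos: "0 < 1 + S $ i $ j" "0 < 1 + S' $ i $ j"
      using mvnormal_orthant_tail(1)[OF S, of i j] mvnormal_orthant_tail(1)[OF S', of i j] by auto
    have "1 / (1 + S $ i $ j) \<le> 1 / (1 + S' $ i $ j)"
      using tail_rate_inequality[OF S S' \<beta>(1) g g' eq r(1) r(1), of i j] by simp
    moreover have "1 / (1 + S' $ i $ j) \<le> 1 / (1 + S $ i $ j)"
      using tail_rate_inequality[OF S' S \<beta>(2) g' g eq[symmetric] r(2) r(2), of i j] by simp
    ultimately have "1 / (1 + S $ i $ j) = 1 / (1 + S' $ i $ j)" by simp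
    then show ?thesis using pos by simp
  qed
  then show "S = S'" by (simp add: vec_eq_iff)
qed

text \<open>On the region where the others' dominant actions are \<open>s\<close>, player \<open>i\<close> enters iff
  \<open>v\<^sub>i > - al i s\<close>; two different thresholds would leave an open set of contradictory play.\<close>

lemma interaction_le:
  fixes g g' :: "('i::finite \<Rightarrow> bool) \<Rightarrow> real^'i \<Rightarrow> real"
  assumes g: "consistent_play al g" and g': "consistent_play al' g'"
    and eq: "AE v in lborel. \<forall>y. g y v = g' y v"
  shows "al' i s \<le> al i s"
proof (rule ccontr)
  assume less: "\<not> al' i s \<le> al i s"
  obtain M1 where M1: "0 \<le> M1" "\<And>i t. \<bar>al i t\<bar> \<le> M1" using bounded_interaction[of al] by blast
  obtain M2 where M2: "0 \<le> M2" "\<And>i t. \<bar>al' i t\<bar> \<le> M2" using bounded_interaction[of al'] by blast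
  define M where "M = max M1 M2"
  have hi: "\<forall>t. 0 < al i t + c" "\<forall>t. 0 < al' i t + c" if "M < c" for i c
    using M1(2)[of i] M2(2)[of i] that unfolding M_def by (smt (verit))+
  have lo: "\<forall>t. al i t + c < 0" "\<forall>t. al' i t + c < 0" if "c < - M" for i c
    using M1(2)[of i] M2(2)[of i] that unfolding M_def by (smt (verit))+
  \<comment> \<open>Coordinate \<open>i\<close> lies between the two thresholds, where
    \<open>al'\<close> demands entry and \<open>al\<close> forbids it; every other coordinate is so
    extreme that \<open>s j\<close> is dominant under both.\<close>
  define T where "T j = (if j = i then {- al' i s <..< - al i s} else if s j then {M<..} else {..<- M})" for j
  have T_ne: "\<exists>c. c \<in> T j" for j
    using less dense[of "- al' i s" "- al i s"] by (auto simp: T_def intro: gt_ex lt_ex)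
  then obtain c where c: "\<And>j. c j \<in> T j" by metis
  have "open {v::real^'i. \<forall>j. v $ j \<in> T j}"
    by (rule open_vector_box) (auto simp: T_def)
  moreover have "(\<chi> j. c j) \<in> {v::real^'i. \<forall>j. v $ j \<in> T j}" using c by simp
  moreover have "AE v in lborel. (\<forall>y. g y v = g' y v)
     \<and> ((\<forall>y. 0 \<le> g y v) \<and> (\<Sum>y\<in>UNIV. g y v) = 1 \<and> (\<forall>y. 0 < g y v \<longrightarrow> dominance_consistent al v y))
     \<and> ((\<forall>y. 0 \<le> g' y v) \<and> (\<Sum>y\<in>UNIV. g' y v) = 1 \<and> (\<forall>y. 0 < g' y v \<longrightarrow> dominance_consistent al' v y))"
    by (rule eventually_conj[OF eq eventually_conj[OF
          g[unfolded consistent_play_def, THEN conjunct2] g'[unfolded consistent_play_def, THEN conjunct2]]])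
  ultimately obtain v where v: "\<And>j. v $ j \<in> T j" and vv: "\<And>y. g y v = g' y v"
    "(\<Sum>y\<in>UNIV. g' y v) = 1" "\<And>y. 0 \<le> g' y v"
    "\<And>y. 0 < g y v \<Longrightarrow> dominance_consistent al v y" "\<And>y. 0 < g' y v \<Longrightarrow> dominance_consistent al' v y"
    using open_AE_lborel_nonempty[of _ "{v::real^'i. \<forall>j. v $ j \<in> T j}"] by (smt (verit) empty_iff mem_Collect_eq)
  have "\<exists>y. 0 < g' y v"
  proof (rule ccontr)
    assume "\<not> ?thesis"
    then have "g' y v = 0" for y using vv(3)[of y] by (metis less_eq_real_def)
    then show False using vv(2) by simp
  qed
  then obtain y where y: "0 < g' y v" ..
  have vj: "if s j then M < v $ j else v $ j < - M" if "j \<noteq> i" for j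
    using v[of j] that by (auto simp: T_def split: if_splits)
  have vi: "0 < al' i s + v $ i" "al i s + v $ i < 0" using v[of i] by (auto simp: T_def)
  have others: "if s j then \<forall>t. 0 < al j t + v $ j else \<forall>t. al j t + v $ j < 0"
    "if s j then \<forall>t. 0 < al' j t + v $ j else \<forall>t. al' j t + v $ j < 0" if "j \<noteq> i" for j
    using vj[OF that] hi[of "v $ j" j] lo[of "v $ j" j] by (simp_all split: if_splits)
  have "y i"
    using dominance_consistent_best_reply[OF vv(5)[OF y] others(2)] vi(1) by blast
  moreover have "0 < g y v" using y vv(1)[of y] by simp
  then have "\<not> y i"
    using dominance_consistent_best_reply[OF vv(4) others(1)] vi(2) by blast
  ultimately show False by simp
qed

text \<open>Agreement is asked at one point of each nonempty open set, since a law with full support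
  yields no more than a dense set of covariates.\<close>

lemma structure_identified:
  fixes S S' :: "real^'i::finite^'i" and \<beta> \<beta>' :: "'i \<Rightarrow> real"
  assumes S: "pos_def S" "\<And>k. S $ k $ k = 1" and S': "pos_def S'" "\<And>k. S' $ k $ k = 1"
    and \<beta>: "\<And>k. \<beta> k \<noteq> 0" "\<And>k. \<beta>' k \<noteq> 0"
    and g: "consistent_play al g" and g': "consistent_play al' g'"
    and dense: "\<And>U. open U \<Longrightarrow> U \<noteq> {} \<Longrightarrow> \<exists>z\<in>U. \<forall>y.
      (\<integral>e. g y ((\<chi> k. \<beta> k * z $ k) - e) \<partial>mvnormal S) = (\<integral>e. g' y ((\<chi> k. \<beta>' k * z $ k) - e) \<partial>mvnormal S')"
  shows "\<beta> = \<beta>' \<and> S = S' \<and> al = al' \<and> (AE v in lborel. \<forall>y. g y v = g' y v)"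
proof -
  define F where "F y z = (\<integral>e. g y ((\<chi> k. \<beta> k * z $ k) - e) \<partial>mvnormal S)" for y and z :: "real^'i"
  define F' where "F' y z = (\<integral>e. g' y ((\<chi> k. \<beta>' k * z $ k) - e) \<partial>mvnormal S')" for y and z :: "real^'i"
  have b: "AE v in lborel. \<bar>g y v\<bar> \<le> 1" "AE v in lborel. \<bar>g' y v\<bar> \<le> 1" for y
    by (rule eventually_mono[OF consistent_play_bounded[OF g, of y]], simp)
      (rule eventually_mono[OF consistent_play_bounded[OF g', of y]], simp)
  have lin: "continuous_on UNIV (\<lambda>z::real^'i. (\<chi> k. c k * z $ k))" for c :: "'i \<Rightarrow> real"
    by (intro continuous_intros)
  have "continuous_on UNIV (F y)" "continuous_on UNIV (F' y)" for y
    unfolding F_def[abs_def] F'_def[abs_def]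
    by (intro continuous_on_compose2[OF continuous_integral_mvnormal_reflect[OF S(1) consistent_play_measurable[OF g] b(1)] lin]
        continuous_on_compose2[OF continuous_integral_mvnormal_reflect[OF S'(1) consistent_play_measurable[OF g'] b(2)] lin] subset_UNIV)+
  then have "open {z. F y z \<noteq> F' y z}" for y
    by (intro open_Collect_neq)
  then have eq: "F y z = F' y z" for y z
    using dense[of "{z. F y z \<noteq> F' y z}"] unfolding F_def F'_def by blast
  note id = coefficients_identified[OF S S' \<beta> g g' eq[unfolded F_def F'_def]]
  have "AE v in lborel. g y v = g' y v" for y
  proof (rule mvnormal_deconvolution[OF S(1)])
    fix u :: "real^'i"
    \<comment> \<open>Nonzero slopes make every index vector \<open>u\<close> attainable, as the
      deconvolution requires.\<close>
    have "(\<chi> k. \<beta> k * (\<chi> k. u $ k / \<beta> k) $ k) = u" using \<beta> by (simp add: vec_eq_iff)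
    then show "(\<integral>e. g y (u - e) \<partial>mvnormal S) = (\<integral>e. g' y (u - e) \<partial>mvnormal S)"
      using eq[of y "\<chi> k. u $ k / \<beta> k"] unfolding F_def F'_def id[symmetric] by simp
  qed (use g g' in \<open>auto intro: consistent_play_measurable consistent_play_bounded simp del: AE_conj_iff\<close>)
  then have AE: "AE v in lborel. \<forall>y. g y v = g' y v" by (simp add: AE_all_countable)
  then have AE': "AE v in lborel. \<forall>y. g' y v = g y v" by (simp add: eq_commute)
  have "al = al'"
    using interaction_le[OF g g' AE] interaction_le[OF g' g AE'] by (intro ext antisym)
  then show ?thesis using id AE by simp
qed

section \<open>Almost sure statements over the covariates\<close>

text \<open>The complement of the support is covered by the null sets of a countable basis.
  Assumptions stated for all \<open>w\<close> in the support thus hold for almost every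
  \<open>w\<close>.\<close>

lemma AE_msupport:
  fixes M :: "'a::second_countable_topology measure"
  assumes sets: "sets M = sets borel"
  shows "AE x in M. x \<in> msupport M"
proof -
  obtain B :: "'a set set" where B: "countable B" "topological_basis B"
    using ex_countable_basis by blast
  have meas: "b \<in> sets M" if "open b" for b using that by (simp add: sets)
  have "(\<Union>b\<in>{b\<in>B. emeasure M b = 0}. b) \<in> null_sets M"
    using B by (intro null_sets_UN') (auto simp: null_sets_def intro!: meas topological_basis_open)
  then have "AE x in M. x \<notin> (\<Union>b\<in>{b\<in>B. emeasure M b = 0}. b)" by (rule AE_not_in)
  then show ?thesis
  proof (rule eventually_mono)
    fix x assume x: "x \<notin> (\<Union>b\<in>{b\<in>B. emeasure M b = 0}. b)"
    show "x \<in> msupport M"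
      unfolding msupport_def
    proof (intro CollectI allI impI)
      fix U assume U: "open U" "x \<in> U"
      then obtain b where b: "b \<in> B" "x \<in> b" "b \<subseteq> U"
        using B(2) by (meson topological_basisE)
      then have "0 < emeasure M b" using x by (auto simp: zero_less_iff_neq_zero)
      also have "\<dots> \<le> emeasure M U" using b U by (intro emeasure_mono meas)
      finally show "0 < emeasure M U" .
    qed
  qed
qed

lemma full_support_AE_dense:
  assumes sets: "sets M = sets borel" and supp: "msupport M = UNIV"
    and AE: "AE z in M. P z" and U: "open U" "U \<noteq> {}"
  shows "\<exists>z\<in>U. P z"
proof (rule ccontr)
  assume "\<not> ?thesis"
  then have "AE z in M. z \<notin> U" using AE by (auto elim!: eventually_mono)
  then have "emeasure M U = 0"
    using U by (subst (asm) AE_iff_measurable[of U]) (auto simp: sets sets_eq_imp_space_eq[OF sets])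
  moreover obtain z where "z \<in> U" using U by auto
  ultimately show False using supp U unfolding msupport_def by (metis (mono_tags, lifting) UNIV_I less_irrefl mem_Collect_eq)
qed

section \<open>Disintegration of the law of the covariates\<close>

lemma case_prod_measurable_Pair:
  assumes "(\<lambda>(x, e). f x e) \<in> borel_measurable (borel \<Otimes>\<^sub>M borel)"
  shows "f x \<in> borel_measurable borel"
  using measurable_compose[OF measurable_Pair1'[of x borel borel] assms] by simp

context
  fixes Pw :: "(real^'dw::finite) measure"
    and K :: "real^'dw \<Rightarrow> (real^'i::finite) measure"
  assumes Pw_prob: "prob_space Pw" and Pw_sets: "sets Pw = sets borel"
    and K_prob: "\<And>w. prob_space (K w)" and K_sets: "\<And>w. sets (K w) = sets borel"
    and K_meas: "K \<in> measurable Pw (subprob_algebra borel)"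
begin

lemma kernel_measurable:
  "(\<lambda>w. distr (K w) borel (\<lambda>z. (z, w))) \<in> measurable Pw (subprob_algebra borel)"
proof (rule measurable_distr2[OF _ K_meas])
  have "(\<lambda>(w :: real^'dw, z :: real^'i). (z, w)) \<in> measurable (borel \<Otimes>\<^sub>M borel) (borel \<Otimes>\<^sub>M borel)" by measurable
  then show "(\<lambda>(w :: real^'dw, z :: real^'i). (z, w)) \<in> measurable (Pw \<Otimes>\<^sub>M borel) borel"
    by (subst measurable_cong_sets[OF sets_pair_measure_cong[OF Pw_sets refl] refl]) (simp only: borel_prod)
qed

lemma pair_measurable_K: "(\<lambda>z. (z, w)) \<in> measurable (K w) borel"
proof -
  have "(\<lambda>z. (z, w)) \<in> measurable borel (borel \<Otimes>\<^sub>M borel)" by measurable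
  then show ?thesis by (subst measurable_cong_sets[OF K_sets refl]) (simp add: borel_prod)
qed

lemma sets_Px: "sets (Px Pw K) = sets borel"
  unfolding Px_def using prob_space.not_empty[OF Pw_prob] by (intro sets_bind) auto

lemma prob_space_Px: "prob_space (Px Pw K)"
  unfolding Px_def
  by (rule prob_space.prob_space_bind[OF Pw_prob _ kernel_measurable])
    (intro AE_I2 prob_space.prob_space_distr K_prob pair_measurable_K)

lemma AE_Px_iff:
  assumes P: "Measurable.pred borel P"
  shows "(AE x in Px Pw K. P x) \<longleftrightarrow> (AE w in Pw. AE z in K w. P (z, w))"
  unfolding Px_def using P
  by (subst AE_bind[OF kernel_measurable P]) (simp add: AE_distr_iff[OF pair_measurable_K] pred_def)

text \<open>Without measurability of \<open>P\<close>: the equivalence is applied to a measurable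
  null set containing the exceptions.\<close>

lemma AE_PxD:
  assumes "AE x in Px Pw K. P x"
  shows "AE w in Pw. AE z in K w. P (z, w)"
proof -
  obtain N where N: "N \<in> null_sets (Px Pw K)" "{x \<in> space (Px Pw K). \<not> P x} \<subseteq> N"
    using assms by (auto simp: eventually_ae_filter)
  have "space (Px Pw K) = UNIV" using sets_eq_imp_space_eq[OF sets_Px] by simp
  then have sub: "\<And>x. x \<notin> N \<Longrightarrow> P x" using N(2) by auto
  have [measurable]: "N \<in> sets borel" using N(1) by (auto simp: null_sets_def sets_Px)
  have "AE x in Px Pw K. x \<notin> N" using N(1) by (rule AE_not_in)
  then have "AE w in Pw. AE z in K w. (z, w) \<notin> N"
    by (subst (asm) AE_Px_iff) measurable
  then show ?thesis by (auto elim!: eventually_mono intro: sub)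
qed

text \<open>Reassembling nested statements into one over the product needs a measurable disagreement
  set. Joint measurability of both plays provides \<open>?B\<close>, whose sections have measure
  depending measurably on \<open>x\<close>.\<close>

lemma AE_Px_lborelI:
  fixes h h' :: "('i,'dw) play"
  assumes h: "\<And>y. (\<lambda>(x, e). h y x e) \<in> borel_measurable (borel \<Otimes>\<^sub>M borel)"
    and h': "\<And>y. (\<lambda>(x, e). h' y x e) \<in> borel_measurable (borel \<Otimes>\<^sub>M borel)"
    and AE: "AE w in Pw. AE z in K w. AE e in lborel. \<forall>y. h y (z, w) e = h' y (z, w) e"
  shows "play_ae_eq Pw K h h'"
proof -
  interpret X: prob_space "Px Pw K" by (rule prob_space_Px)
  interpret pair_sigma_finite "Px Pw K" "lborel :: (real^'i) measure" ..
  let ?B = "{p. \<exists>y. (case p of (x, e) \<Rightarrow> h y x e) \<noteq> (case p of (x, e) \<Rightarrow> h' y x e)}"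
  note [measurable] = h h'
  have "{p \<in> space (borel \<Otimes>\<^sub>M borel). \<exists>y. (case p of (x, e) \<Rightarrow> h y x e) \<noteq> (case p of (x, e) \<Rightarrow> h' y x e)}
      \<in> sets (borel \<Otimes>\<^sub>M borel)"
    by measurable
  then have B[measurable]: "?B \<in> sets (borel \<Otimes>\<^sub>M borel)"
    by (simp add: space_pair_measure)
  have B': "?B \<in> sets (borel \<Otimes>\<^sub>M lborel)" using B by simp
  have null: "(AE e in lborel. \<forall>y. h y x e = h' y x e) \<longleftrightarrow> emeasure lborel (Pair x -` ?B) = 0" for x
    using sets_Pair1[OF B', of x] by (intro AE_iff_measurable) auto
  have "(\<lambda>x. emeasure lborel (Pair x -` ?B)) \<in> borel_measurable borel"
    by (rule lborel.measurable_emeasure_Pair[OF B'])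
  then have "Measurable.pred borel (\<lambda>x. emeasure lborel (Pair x -` ?B) = 0)"
    by measurable
  then have "Measurable.pred borel (\<lambda>x. AE e in lborel. \<forall>y. h y x e = h' y x e)"
    by (simp only: null)
  from AE_Px_iff[OF this] AE have "AE x in Px Pw K. AE e in lborel. \<forall>y. h y x e = h' y x e"
    by simp
  moreover have "{p \<in> space (Px Pw K \<Otimes>\<^sub>M lborel). case p of (x, e) \<Rightarrow> \<forall>y. h y x e = h' y x e}
      \<in> sets (Px Pw K \<Otimes>\<^sub>M lborel)"
  proof -
    have "{p \<in> space (Px Pw K \<Otimes>\<^sub>M lborel). case p of (x, e) \<Rightarrow> \<forall>y. h y x e = h' y x e} = - ?B"
      using sets_eq_imp_space_eq[OF sets_Px] by (auto simp: space_pair_measure)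
    also have "\<dots> \<in> sets (borel \<Otimes>\<^sub>M borel)" using sets.compl_sets[OF B] by (simp add: space_pair_measure Compl_eq_Diff_UNIV)
    also have "sets (borel \<Otimes>\<^sub>M borel) = sets (Px Pw K \<Otimes>\<^sub>M lborel)"
      by (intro sets_pair_measure_cong) (simp_all add: sets_Px)
    finally show ?thesis .
  qed
  ultimately show ?thesis
    unfolding play_ae_eq_def by (intro AE_pair_measure) auto
qed

lemma Psi_R_index_form:
  assumes "(\<theta>, h) \<in> Psi_R Pw K"
  obtains ht where "\<And>y w. ht y w \<in> borel_measurable borel"
    and "AE w in Pw. AE z in K w. AE e in lborel. \<forall>y. h y (z, w) e = ht y w ((\<chi> i. beta \<theta> i w * z $ i) - e)"
proof -
  interpret X: prob_space "Px Pw K" by (rule prob_space_Px)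
  interpret pair_sigma_finite "Px Pw K" "lborel :: (real^'i) measure" ..
  obtain ht where ht: "\<And>y. (\<lambda>(w, v). ht y w v) \<in> borel_measurable (borel \<Otimes>\<^sub>M borel)"
    "AE (x, e) in Px Pw K \<Otimes>\<^sub>M lborel. \<forall>y. h y x e = ht y (snd x) (\<chi> i. beta \<theta> i (snd x) * (fst x $ i) - e $ i)"
    using assms unfolding Psi_R_def by auto
  have "AE x in Px Pw K. AE e in lborel. \<forall>y. h y x e = ht y (snd x) (\<chi> i. beta \<theta> i (snd x) * (fst x $ i) - e $ i)"
    using AE_pair[OF ht(2)] by simp
  then have "AE w in Pw. AE z in K w. AE e in lborel. \<forall>y. h y (z, w) e = ht y w (\<chi> i. beta \<theta> i w * (z $ i) - e $ i)"
    using AE_PxD by fastforce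
  moreover have "(\<chi> i. c i * z $ i - e $ i) = (\<chi> i. c i * z $ i) - e" for c and z e :: "real^'i"
    by (simp add: vec_eq_iff)
  ultimately show ?thesis
    using that[of ht] case_prod_measurable_Pair[OF ht(1)] by simp
qed

text \<open>A single typical \<open>z\<close> suffices: reflecting \<open>e\<close> into the index
  \<open>v\<close> preserves Lebesgue null sets, and \<open>ht y w\<close> does not depend on
  \<open>z\<close>.\<close>

lemma Psi_R_consistent_play:
  assumes \<theta>: "\<theta> \<in> Theta" and h: "h \<in> S_R \<theta>" and ht: "\<And>y. ht y w \<in> borel_measurable borel"
    and eq: "AE e in lborel. \<forall>y. h y (z, w) e = ht y w ((\<chi> i. beta \<theta> i w * z $ i) - e)"
  shows "consistent_play (\<lambda>i t. alpha \<theta> i t w) (\<lambda>y. ht y w)"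
proof -
  let ?b = "\<chi> i. beta \<theta> i w * z $ i"
  have "AE v in lborel. \<forall>y. h y (z, w) (?b - v) = ht y w v"
    using eq by (subst (asm) AE_lborel_reflect_iff[of _ ?b, symmetric]) simp
  then have "AE v in lborel. (\<forall>y. 0 \<le> ht y w v) \<and> (\<Sum>y\<in>UNIV. ht y w v) = 1
        \<and> (\<forall>y. 0 < ht y w v \<longrightarrow> dominance_consistent (\<lambda>i t. alpha \<theta> i t w) v y)"
  proof (rule eventually_mono)
    fix v assume v: "\<forall>y. h y (z, w) (?b - v) = ht y w v"
    have v': "(\<chi> i. beta \<theta> i w * z $ i - (?b - v) $ i) = v" by (simp add: vec_eq_iff)
    have "0 \<le> ht y w v" for y using h v unfolding S_R_def Hset_def by (metis (mono_tags, lifting) mem_Collect_eq)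
    moreover have "(\<Sum>y\<in>UNIV. h y (z, w) (?b - v)) = 1" using h by (simp add: S_R_def Hset_def)
    moreover have "dominance_consistent (\<lambda>i t. alpha \<theta> i t w) v y" if "0 < ht y w v" for y
    proof -
      have "y \<in> rationalizable \<theta> (z, w) (?b - v)" using h v that by (simp add: S_R_def)
      from rationalizable_dominance_consistent[OF \<theta> this] show ?thesis using v' by simp
    qed
    ultimately show "(\<forall>y. 0 \<le> ht y w v) \<and> (\<Sum>y\<in>UNIV. ht y w v) = 1
        \<and> (\<forall>y. 0 < ht y w v \<longrightarrow> dominance_consistent (\<lambda>i t. alpha \<theta> i t w) v y)"
      using v by simp
  qed
  then show ?thesis using ht by (simp only: consistent_play_def) simp
qed

lemma observational_equivalence_imp_ae_eq:
  assumes mem: "(\<theta>, h) \<in> Psi_R Pw K" and mem': "(\<theta>', h') \<in> Psi_R Pw K"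
    and eq: "AE x in Px Pw K. \<forall>y. condE \<theta> h y x = condE \<theta>' h' y x"
  shows "param_ae_eq Pw \<theta> \<theta>'" "play_ae_eq Pw K h h'"
proof -
  have \<theta>: "\<theta> \<in> Theta" "h \<in> S_R \<theta>" and \<theta>': "\<theta>' \<in> Theta" "h' \<in> S_R \<theta>'"
    using mem mem' by (auto simp: Psi_R_def)
  have A: "msupport (K w) = UNIV" "beta \<theta> i w \<noteq> 0" "beta \<theta>' i w \<noteq> 0"
    "pos_def (Sigma \<theta> w)" "Sigma \<theta> w $ i $ i = 1" "pos_def (Sigma \<theta>' w)" "Sigma \<theta>' w $ i $ i = 1"
    if "w \<in> msupport Pw" for i w
    using mem mem' that by (auto simp: Psi_R_def)
  have h[measurable]: "\<And>y. (\<lambda>(x, e). h y x e) \<in> borel_measurable (borel \<Otimes>\<^sub>M borel)"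
    "\<And>y. (\<lambda>(x, e). h' y x e) \<in> borel_measurable (borel \<Otimes>\<^sub>M borel)"
    using \<theta>(2) \<theta>'(2) by (auto simp: S_R_def Hset_def)
  obtain ht where ht[measurable]: "\<And>y w. ht y w \<in> borel_measurable borel"
    and eq_ht: "AE w in Pw. AE z in K w. AE e in lborel. \<forall>y. h y (z, w) e = ht y w ((\<chi> i. beta \<theta> i w * z $ i) - e)"
    using Psi_R_index_form[OF mem] by blast
  obtain ht' where ht'[measurable]: "\<And>y w. ht' y w \<in> borel_measurable borel"
    and eq_ht': "AE w in Pw. AE z in K w. AE e in lborel. \<forall>y. h' y (z, w) e = ht' y w ((\<chi> i. beta \<theta>' i w * z $ i) - e)"
    using Psi_R_index_form[OF mem'] by blast
  have main: "AE w in Pw. ((\<lambda>i. beta \<theta> i w) = (\<lambda>i. beta \<theta>' i w) \<and> Sigma \<theta> w = Sigma \<theta>' w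
      \<and> (\<lambda>i t. alpha \<theta> i t w) = (\<lambda>i t. alpha \<theta>' i t w))
      \<and> (AE z in K w. AE e in lborel. \<forall>y. h y (z, w) e = h' y (z, w) e)"
    using AE_msupport[OF Pw_sets] AE_PxD[OF eq] eq_ht eq_ht'
  proof eventually_elim
    fix w assume w: "w \<in> msupport Pw"
      and c: "AE z in K w. \<forall>y. condE \<theta> h y (z, w) = condE \<theta>' h' y (z, w)"
      and t: "AE z in K w. AE e in lborel. \<forall>y. h y (z, w) e = ht y w ((\<chi> i. beta \<theta> i w * z $ i) - e)"
      and t': "AE z in K w. AE e in lborel. \<forall>y. h' y (z, w) e = ht' y w ((\<chi> i. beta \<theta>' i w * z $ i) - e)"
    note dense = full_support_AE_dense[OF K_sets A(1)[OF w]]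
    \<comment> \<open>One typical point for each pair makes its index form a consistent play; the
      two points may differ.\<close>
    from dense[OF t open_UNIV] obtain z where
      z: "AE e in lborel. \<forall>y. h y (z, w) e = ht y w ((\<chi> i. beta \<theta> i w * z $ i) - e)" by auto
    from dense[OF t' open_UNIV] obtain z' where
      z': "AE e in lborel. \<forall>y. h' y (z', w) e = ht' y w ((\<chi> i. beta \<theta>' i w * z' $ i) - e)" by auto
    note g = Psi_R_consistent_play[where ht=ht, OF \<theta> ht z] and g' = Psi_R_consistent_play[where ht=ht', OF \<theta>' ht' z']
    have "AE z in K w. \<forall>y. (\<integral>e. ht y w ((\<chi> i. beta \<theta> i w * z $ i) - e) \<partial>mvnormal (Sigma \<theta> w))
        = (\<integral>e. ht' y w ((\<chi> i. beta \<theta>' i w * z $ i) - e) \<partial>mvnormal (Sigma \<theta>' w))"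
      using c t t'
    proof (eventually_elim, intro allI)
      fix z y assume c: "\<forall>y. condE \<theta> h y (z, w) = condE \<theta>' h' y (z, w)"
        and e: "AE e in lborel. \<forall>y. h y (z, w) e = ht y w ((\<chi> i. beta \<theta> i w * z $ i) - e)"
          "AE e in lborel. \<forall>y. h' y (z, w) e = ht' y w ((\<chi> i. beta \<theta>' i w * z $ i) - e)"
      have hm[measurable]: "h y (z, w) \<in> borel_measurable borel" "h' y (z, w) \<in> borel_measurable borel"
        by (rule case_prod_measurable_Pair[OF h(1)] case_prod_measurable_Pair[OF h(2)])+
      have "(\<integral>e. ht y w ((\<chi> i. beta \<theta> i w * z $ i) - e) \<partial>mvnormal (Sigma \<theta> w)) = condE \<theta> h y (z, w)"
        unfolding condE_def snd_conv
      proof (rule integral_cong_AE)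
        show "AE e in mvnormal (Sigma \<theta> w). ht y w ((\<chi> i. beta \<theta> i w * z $ i) - e) = h y (z, w) e"
          unfolding AE_mvnormal_iff[OF A(4)[OF w]] using e(1) by (rule eventually_mono) simp
      qed measurable
      moreover have "(\<integral>e. ht' y w ((\<chi> i. beta \<theta>' i w * z $ i) - e) \<partial>mvnormal (Sigma \<theta>' w)) = condE \<theta>' h' y (z, w)"
        unfolding condE_def snd_conv
      proof (rule integral_cong_AE)
        show "AE e in mvnormal (Sigma \<theta>' w). ht' y w ((\<chi> i. beta \<theta>' i w * z $ i) - e) = h' y (z, w) e"
          unfolding AE_mvnormal_iff[OF A(6)[OF w]] using e(2) by (rule eventually_mono) simp
      qed measurable
      ultimately show "(\<integral>e. ht y w ((\<chi> i. beta \<theta> i w * z $ i) - e) \<partial>mvnormal (Sigma \<theta> w))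
        = (\<integral>e. ht' y w ((\<chi> i. beta \<theta>' i w * z $ i) - e) \<partial>mvnormal (Sigma \<theta>' w))"
        using c by simp
    qed
    note id = structure_identified[OF A(4)[OF w] A(5)[OF w] A(6)[OF w] A(7)[OF w] A(2)[OF w] A(3)[OF w] g g' dense[OF this]]
    have "AE z in K w. AE e in lborel. \<forall>y. h y (z, w) e = h' y (z, w) e"
      using t t'
    proof eventually_elim
      fix z assume e: "AE e in lborel. \<forall>y. h y (z, w) e = ht y w ((\<chi> i. beta \<theta> i w * z $ i) - e)"
          "AE e in lborel. \<forall>y. h' y (z, w) e = ht' y w ((\<chi> i. beta \<theta>' i w * z $ i) - e)"
      \<comment> \<open>Reflection carries the agreement in \<open>v\<close> back to
        \<open>e\<close> for each fixed \<open>z\<close>; equal slopes then let both plays be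
        evaluated at the same index.\<close>
      have "AE e in lborel. \<forall>y. ht y w ((\<chi> i. beta \<theta> i w * z $ i) - e) = ht' y w ((\<chi> i. beta \<theta> i w * z $ i) - e)"
        using id by (subst AE_lborel_reflect_iff) blast
      with e show "AE e in lborel. \<forall>y. h y (z, w) e = h' y (z, w) e"
      proof eventually_elim
        have "beta \<theta> i w = beta \<theta>' i w" for i using id by meson
        then show "\<forall>y. h y (z, w) e = h' y (z, w) e"
          if "\<forall>y. h y (z, w) e = ht y w ((\<chi> i. beta \<theta> i w * z $ i) - e)"
            "\<forall>y. h' y (z, w) e = ht' y w ((\<chi> i. beta \<theta>' i w * z $ i) - e)"
            "\<forall>y. ht y w ((\<chi> i. beta \<theta> i w * z $ i) - e) = ht' y w ((\<chi> i. beta \<theta> i w * z $ i) - e)" for e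
          using that by simp
      qed
    qed
    then show "((\<lambda>i. beta \<theta> i w) = (\<lambda>i. beta \<theta>' i w) \<and> Sigma \<theta> w = Sigma \<theta>' w
      \<and> (\<lambda>i t. alpha \<theta> i t w) = (\<lambda>i t. alpha \<theta>' i t w))
      \<and> (AE z in K w. AE e in lborel. \<forall>y. h y (z, w) e = h' y (z, w) e)"
      using id by blast
  qed
  show "param_ae_eq Pw \<theta> \<theta>'"
    unfolding param_ae_eq_def using main by (rule eventually_mono) (metis (no_types, lifting))
  show "play_ae_eq Pw K h h'"
    by (rule AE_Px_lborelI[OF h]) (use main in \<open>rule eventually_mono, blast\<close>)
qed

end

theorem theorem1:
  fixes Pw :: "(real^'dw::finite) measure"
    and K :: "real^'dw \<Rightarrow> (real^'i::finite) measure"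
    and S :: "('i,'dw) param \<Rightarrow> ('i,'dw) play set"
  assumes players: "2 \<le> CARD('i)"
    and Pw_prob: "prob_space Pw" and Pw_sets: "sets Pw = sets borel"
    and K_prob: "\<And>w. prob_space (K w)" and K_sets: "\<And>w. sets (K w) = sets borel"
    and K_meas: "K \<in> measurable Pw (subprob_algebra borel)"
    and nested: "\<And>\<theta>. \<theta> \<in> Theta \<Longrightarrow> S \<theta> \<subseteq> S_R \<theta>"
    and null_sets: "\<And>\<theta> \<theta>' h h'. \<theta> \<in> Theta \<Longrightarrow> \<theta>' \<in> Theta \<Longrightarrow> h \<in> S \<theta> \<Longrightarrow> h' \<in> S_R \<theta>'
        \<Longrightarrow> param_ae_eq Pw \<theta> \<theta>' \<Longrightarrow> play_ae_eq Pw K h h' \<Longrightarrow> h' \<in> S \<theta>'"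
  shows "discernible Pw K S (Psi_R Pw K)"
  unfolding discernible_def
proof (rule notI, elim exE conjE)
  fix \<theta> h \<theta>' h'
  assume mem: "(\<theta>, h) \<in> Psi_R Pw K" "(\<theta>', h') \<in> Psi_R Pw K"
    and S: "h \<in> S \<theta>" "h' \<notin> S \<theta>'"
    and eq: "AE x in Px Pw K. \<forall>y. condE \<theta> h y x = condE \<theta>' h' y x"
  have "\<theta> \<in> Theta" "\<theta>' \<in> Theta" "h' \<in> S_R \<theta>'" using mem by (auto simp: Psi_R_def)
  then have "h' \<in> S \<theta>'"
    using observational_equivalence_imp_ae_eq[OF Pw_prob Pw_sets K_prob K_sets K_meas mem eq] S
    by (intro null_sets[of \<theta> \<theta>' h h'])
  then show False using S by simp
qed

end
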